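(* Let $\mathcal{C}:\mathcal{P}(\mathbb{R}^n)\to[0,\infty]$ be an outer capacity which satisfies the packing assumption (P) and is doubling. For every $f\in L^1(\mathbb{R}^n;\mathcal{C})$ one has $$\lim_{r\to0}\frac{1}{\mathcal{C}(B(x,r))}\int_{B(x,r)}|f-f(x)|\,d\mathcal{C}=0$$ for $\mathcal{C}$-quasi every $x\in\mathbb{R}^n$.
   Context: Outer capacity: a set function $\mathcal{C}:\mathcal{P}(\mathbb{R}^n)\to[0,\infty]$ with $\mathcal{C}(\emptyset)=0$; $A\subset B\Rightarrow\mathcal{C}(A)\le\mathcal{C}(B)$; $A\subset\bigcup_{i=1}^\infty A_i\Rightarrow\mathcal{C}(A)\le\sum_i\mathcal{C}(A_i)$; and $\mathcal{C}(A)=\inf\{\mathcal{C}(U): A\subset U,\ U\text{ open}\}$. Doubling: there is $D_0>0$ with $\mathcal{C}(B(x,2r))\le D_0\,\mathcal{C}(B(x,r))$ for all $x\in\mathbb{R}^n$, $r>0$, where $B(x,r)$ is the open ball. Dyadic cubes. Fix a half-open cube $Q=[x_1,x_1+\ell)\times\cdots\times[x_n,x_n+\ell)\subset\mathbb{R}^n$, $\ell>0$, and put $x_Q=(x_1,\dots,x_n)$. Let $\mathcal{D}_0(Q)=\{x_Q+2^k\ell(m+[0,1)^n): k\in\mathbb{Z}, m\in\mathbb{Z}^n\}$ and $\mathcal{D}(Q)=\mathcal{D}_0(Q)\cup\{\prod_{i=1}^n I_i: I_i=[x_i,\infty)\text{ or }(-\infty,x_i)\}$. Choquet integral. $\int_A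 f\,d\mathcal{C}=\int_0^\infty\mathcal{C}(\{x\in A: f(x)>t\})\,dt$ for $f\ge0$. Convention: $0\cdot\infty=0$, and an average over a set of zero capacity is $0$. Packing assumption (P): there is a constant $A_0\ge1$ such that for every non-overlapping collection $\{Q_j\}\subset\mathcal{D}(Q)$ satisfying $\sum_{Q_j\subset Q'}\mathcal{C}(Q_j)\le A_0\,\mathcal{C}(Q')$ for every $Q'\in\mathcal{D}(Q)$, one has $\sum_j\int_{Q_j}f\,d\mathcal{C}\le A_0\int_{\cup_jQ_j}f\,d\mathcal{C}$ for every $f:\mathbb{R}^n\to[0,\infty]$. $L^1(\mathbb{R}^n;\mathcal{C})$ is the set of $\mathcal{C}$-quasicontinuous $f:\mathbb{R}^n\to\mathbb{R}$ with $\int_{\mathbb{R}^n}|f|\,d\mathcal{C}<\infty$; $f$ is $\mathcal{C}$-quasicontinuous if for every $\epsilon>0$ there is an open set $O_\epsilon$ with $\mathcal{C}(O_\epsilon)<\epsilon$ and $f|_{O_\epsilon^c}$ continuous. "For $\mathcal{C}$-quasi every $x$" means: outside some set $E$ with $\mathcal{C}(E)=0$. *)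

theory Defs
  imports "HOL-Analysis.Analysis"
begin

definition outer_capacity :: "((real ^ 'n) set \<Rightarrow> ennreal) \<Rightarrow> bool" where
  "outer_capacity C \<longleftrightarrow>
     C {} = 0 \<and>
     (\<forall>A B. A \<subseteq> B \<longrightarrow> C A \<le> C B) \<and>
     (\<forall>A (F :: nat \<Rightarrow> (real ^ 'n) set). A \<subseteq> (\<Union>i. F i) \<longrightarrow> C A \<le> (\<Sum>i. C (F i))) \<and>
     (\<forall>A. C A = (INF U\<in>{U. open U \<and> A \<subseteq> U}. C U))"

definition doubling :: "((real ^ 'n) set \<Rightarrow> ennreal) \<Rightarrow> bool" where
  "doubling C \<longleftrightarrow>
     (\<exists>D0::real. D0 > 0 \<and>
        (\<forall>x r. r > 0 \<longrightarrow> C (ball x (2 * r)) \<le> ennreal D0 * C (ball x r)))"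

text \<open>The half-open cube \<open>Q\<close> is given by its corner \<open>xQ\<close> and side length \<open>l\<close>.\<close>

definition dyadic_cubes0 :: "real ^ 'n \<Rightarrow> real \<Rightarrow> (real ^ 'n) set set" where
  "dyadic_cubes0 xQ l =
     {{xQ + (2 powi k * l) *\<^sub>R ((\<chi> i. real_of_int (m $ i)) + z) | z. \<forall>i. z $ i \<in> {0..<1}}
        | (k :: int) (m :: int ^ 'n). True}"

definition dyadic_quadrants :: "real ^ 'n \<Rightarrow> (real ^ 'n) set set" where
  "dyadic_quadrants xQ =
     {{y. \<forall>i. y $ i \<in> I i} | I. \<forall>i. I i = {xQ $ i..} \<or> I i = {..<xQ $ i}}"

definition dyadic_cubes :: "real ^ 'n \<Rightarrow> real \<Rightarrow> (real ^ 'n) set set" where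
  "dyadic_cubes xQ l = dyadic_cubes0 xQ l \<union> dyadic_quadrants xQ"

text \<open>The integrand is antitone in \<open>t\<close>, hence Borel measurable for every monotone \<open>C\<close>, without
  any measurability of \<open>f\<close> or \<open>A\<close>.\<close>

definition choquet_integral ::
    "((real ^ 'n) set \<Rightarrow> ennreal) \<Rightarrow> (real ^ 'n) set \<Rightarrow> (real ^ 'n \<Rightarrow> ennreal) \<Rightarrow> ennreal" where
  "choquet_integral C A f = (\<integral>\<^sup>+t\<in>{0<..}. C {x \<in> A. f x > ennreal t} \<partial>lborel)"

text \<open>For \<open>C A = \<infinity>\<close>, \<open>ennreal\<close> arithmetic gives \<open>1 / \<infinity> = 0\<close> and \<open>0 * \<infinity> = 0\<close>.\<close>

definition choquet_average ::
    "((real ^ 'n) set \<Rightarrow> ennreal) \<Rightarrow> (real ^ 'n) set \<Rightarrow> (real ^ 'n \<Rightarrow> ennreal) \<Rightarrow> ennreal" where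
  "choquet_average C A f = (if C A = 0 then 0 else 1 / C A * choquet_integral C A f)"

definition non_overlapping :: "(real ^ 'n) set set \<Rightarrow> bool" where
  "non_overlapping S \<longleftrightarrow> pairwise (\<lambda>P R. interior P \<inter> interior R = {}) S"

text \<open>A non-overlapping family of dyadic cubes has no repetitions, so it is represented by a set of
  cubes. Every family in \<open>ennreal\<close> is summable, so \<open>infsum\<close> never takes its default value here.\<close>

definition packing_assumption ::
    "real ^ 'n \<Rightarrow> real \<Rightarrow> ((real ^ 'n) set \<Rightarrow> ennreal) \<Rightarrow> bool" where
  "packing_assumption xQ l C \<longleftrightarrow>
     (\<exists>A0::real. A0 \<ge> 1 \<and>
        (\<forall>S. S \<subseteq> dyadic_cubes xQ l \<longrightarrow> non_overlapping S \<longrightarrow>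
             (\<forall>Q'\<in>dyadic_cubes xQ l.
                (\<Sum>\<^sub>\<infinity>P\<in>{P \<in> S. P \<subseteq> Q'}. C P) \<le> ennreal A0 * C Q') \<longrightarrow>
             (\<forall>f :: real ^ 'n \<Rightarrow> ennreal.
                (\<Sum>\<^sub>\<infinity>P\<in>S. choquet_integral C P f) \<le> ennreal A0 * choquet_integral C (\<Union>S) f)))"

definition quasicontinuous ::
    "((real ^ 'n) set \<Rightarrow> ennreal) \<Rightarrow> (real ^ 'n \<Rightarrow> real) \<Rightarrow> bool" where
  "quasicontinuous C f \<longleftrightarrow>
     (\<forall>e::real. e > 0 \<longrightarrow> (\<exists>U. open U \<and> C U < ennreal e \<and> continuous_on (- U) f))"

definition L1_capacity :: "((real ^ 'n) set \<Rightarrow> ennreal) \<Rightarrow> (real ^ 'n \<Rightarrow> real) set" where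
  "L1_capacity C =
     {f. quasicontinuous C f \<and> choquet_integral C UNIV (\<lambda>x. ennreal \<bar>f x\<bar>) < \<infinity>}"

definition quasi_every ::
    "((real ^ 'n) set \<Rightarrow> ennreal) \<Rightarrow> (real ^ 'n \<Rightarrow> bool) \<Rightarrow> bool" where
  "quasi_every C P \<longleftrightarrow> (\<exists>E. C E = 0 \<and> (\<forall>x. x \<notin> E \<longrightarrow> P x))"

end

theory Submission
  imports Defs
begin

text \<open>The main step is a weak-type estimate for the local maximal function. If the average of \<open>h\<close> over
  a small ball is large, then so is its average over one of the boundedly many dyadic cubes of
  comparable size that cover the ball. From the maximal such cubes one selects greedily a subfamily
  that satisfies the packing condition and still controls, up to a constant, the capacity of the
  union of all dilated cubes; the packing assumption then bounds the sum of the capacities of the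
  selected cubes by the Choquet integral of \<open>h\<close>. The theorem follows by approximation: truncation,
  quasicontinuity and Tietze's theorem give a continuous \<open>g\<close> for which the integral of \<open>\<bar>f - g\<bar>\<close>
  is arbitrarily small. If some ball has capacity 0 or \<open>\<infinity>\<close>, then by doubling so has every ball,
  and all averages vanish by convention.\<close>

section \<open>Sums of extended nonnegative reals\<close>

text \<open>A capacity is not additive on disjoint cubes, so disjointness alone does not bound a sum
  of integrals over cubes. (P) takes the place of additivity, but only for families packed with the
  very constant \<open>A0\<close> that it supplies, which may be as small as 1. The selection must
  therefore lose nothing in the packing constant; the loss is moved into the covering constant.
  Restricting the radii to at most \<open>l\<close> bounds the levels of the cubes, so that maximal
  cubes exist, and it is harmless for a limit at radius 0.\<close>

lemma infsum_ennreal_leI: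
  fixes f :: "'a \<Rightarrow> ennreal"
  assumes "\<And>F. finite F \<Longrightarrow> F \<subseteq> A \<Longrightarrow> sum f F \<le> c"
  shows "infsum f A \<le> c"
  by (subst nonneg_infsum_complete) (auto intro!: SUP_least assms)

lemma sum_le_infsum_ennreal:
  fixes f :: "'a \<Rightarrow> ennreal"
  assumes "finite F" "F \<subseteq> A"
  shows "sum f F \<le> infsum f A"
  by (subst nonneg_infsum_complete) (auto intro!: SUP_upper assms)

lemma infsum_mono_ennreal:
  fixes f g :: "'a \<Rightarrow> ennreal"
  assumes "\<And>x. x \<in> A \<Longrightarrow> f x \<le> g x"
  shows "infsum f A \<le> infsum g A"
  by (intro infsum_mono nonneg_summable_on_complete assms) auto

lemma infsum_mono_set_ennreal:
  fixes f :: "'a \<Rightarrow> ennreal"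
  assumes "A \<subseteq> B"
  shows "infsum f A \<le> infsum f B"
  by (rule infsum_ennreal_leI) (use assms sum_le_infsum_ennreal in blast)

lemma infsum_cmult_ennreal:
  fixes f :: "'a \<Rightarrow> ennreal"
  shows "infsum (\<lambda>x. c * f x) A = c * infsum f A"
  by (simp add: nonneg_infsum_complete SUP_mult_left_ennreal flip: sum_distrib_left)

text \<open>Intended for \<open>B p\<close> the set of selected cubes inside a maximal cube
  \<open>p\<close>: no selected cube is counted for two maximal cubes.\<close>

lemma infsum_disjoint_UN_le_ennreal:
  fixes w :: "'b \<Rightarrow> ennreal"
  assumes disj: "\<And>p q. p \<in> G \<Longrightarrow> q \<in> G \<Longrightarrow> p \<noteq> q \<Longrightarrow> B p \<inter> B q = {}"
    and sub: "\<And>p. p \<in> G \<Longrightarrow> B p \<subseteq> S"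
  shows "(\<Sum>\<^sub>\<infinity>p\<in>G. infsum w (B p)) \<le> infsum w S"
proof (rule infsum_ennreal_leI)
  fix F assume "finite F" "F \<subseteq> G"
  then have "(\<Sum>p\<in>F. infsum w (B p)) = infsum w (\<Union>p\<in>F. B p)"
  proof (induction F rule: finite_induct)
    case (insert p F)
    have "B p \<inter> (\<Union>q\<in>F. B q) = {}"
      using insert.prems insert.hyps disj[of p] by blast
    then have "infsum w (B p \<union> (\<Union>q\<in>F. B q)) = infsum w (B p) + infsum w (\<Union>q\<in>F. B q)"
      by (intro infsum_Un_disjoint nonneg_summable_on_complete) auto
    then show ?case using insert by simp
  qed simp
  also have "\<dots> \<le> infsum w S"
    using \<open>F \<subseteq> G\<close> sub by (intro infsum_mono_set_ennreal) blast
  finally show "(\<Sum>p\<in>F. infsum w (B p)) \<le> infsum w S" .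
qed

section \<open>Greedy selection\<close>

text \<open>Weights that agree up to a factor 2 are given the same level. The weights are processed level
  by level in decreasing order, so a rejected weight is at most twice each of the weights already
  accepted. This is what makes the argument work for every packing constant \<open>A \<ge> 1\<close>.\<close>

lemma packed_subfamily:
  fixes w :: "'a \<Rightarrow> ennreal" and c :: "'b \<Rightarrow> ennreal" and A W :: ennreal
  assumes cnt: "countable J"
    and pos: "\<And>j. j \<in> J \<Longrightarrow> 0 < w j"
    and bnd: "\<And>j. j \<in> J \<Longrightarrow> w j \<le> W" and Wfin: "W < \<infinity>"
    and dom: "\<And>j q. j \<in> J \<Longrightarrow> q \<in> K \<Longrightarrow> R j q \<Longrightarrow> w j \<le> c q"
    and A: "1 \<le> A"
  obtains S where "S \<subseteq> J"
    and "\<And>q. q \<in> K \<Longrightarrow> (\<Sum>\<^sub>\<infinity>i\<in>{i\<in>S. R i q}. w i) \<le> A * c q"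
    and "\<And>j. j \<in> J - S \<Longrightarrow> \<exists>q\<in>K. R j q \<and> c q \<le> 3 * (\<Sum>\<^sub>\<infinity>i\<in>{i\<in>S. R i q}. w i)"
proof -
  have ex: "\<exists>n. W < 2 ^ Suc n * w j" if j: "j \<in> J" for j
  proof (cases "W = 0")
    case True
    then show ?thesis using pos[OF j] bnd[OF j] by auto
  next
    case False
    have "w j < \<infinity>" using bnd[OF j] Wfin by (rule order.strict_trans1)
    then obtain u where u: "w j = ennreal u" "u > 0"
      using pos[OF j] by (cases "w j") auto
    obtain v where v: "W = ennreal v" "v \<ge> 0"
      using Wfin by (cases W) auto
    obtain n where n: "v / u < 2 ^ n" using real_arch_pow[of 2 "v / u"] by auto
    have "v < 2 ^ n * u" using n u(2) by (simp add: field_simps)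
    also have "\<dots> \<le> 2 ^ Suc n * u" using u(2) by simp
    finally have "v < 2 ^ Suc n * u" .
    then have "ennreal v < ennreal (2 ^ Suc n * u)"
      using v by (subst ennreal_less_iff) auto
    also have "\<dots> = 2 ^ Suc n * ennreal u"
      using u(2) by (simp add: ennreal_mult flip: ennreal_power)
    finally show ?thesis using u(1) v(1) by metis
  qed
  \<comment> \<open>Level n collects the weights between W / 2^(n+1), exclusive, and W / 2^n,
    inclusive.\<close>
  define lv where "lv j = (LEAST n. W < 2 ^ Suc n * w j)" for j
  have lv: "W < 2 ^ Suc (lv j) * w j" if "j \<in> J" for j
    unfolding lv_def by (rule LeastI_ex[OF ex[OF that]])
  have comparable: "w j \<le> 2 * w i" if "i \<in> J" "j \<in> J" "lv i \<le> lv j" for i j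
  proof -
    have "2 ^ lv j * w j \<le> W"
    proof (cases "lv j")
      case 0
      then show ?thesis using bnd[OF that(2)] by simp
    next
      case (Suc m)
      then have "\<not> W < 2 ^ Suc m * w j"
        unfolding lv_def using not_less_Least by (metis lessI)
      then show ?thesis using Suc by simp
    qed
    also have "\<dots> \<le> 2 ^ Suc (lv i) * w i" using lv[OF that(1)] by simp
    also have "\<dots> \<le> 2 ^ Suc (lv j) * w i"
      by (intro mult_right_mono power_increasing) (use that in auto)
    also have "\<dots> = 2 ^ lv j * (2 * w i)" by (simp add: mult_ac)
    finally have "2 ^ lv j * w j \<le> 2 ^ lv j * (2 * w i)" .
    moreover have "(2::ennreal) ^ lv j = ennreal (2 ^ lv j)"
      by (simp flip: ennreal_power)
    ultimately show ?thesis
      by (simp add: ennreal_mult_le_mult_iff)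
  qed
  \<comment> \<open>Levels come first and an enumeration breaks ties. An index may have infinitely
    many predecessors, so the selection is a well-founded recursion and not a recursion along the
    natural numbers.\<close>
  define r where "r = inv_image (less_than <*lex*> less_than) (\<lambda>j. (lv j, to_nat_on J j))"
  have wfr: "wf r" unfolding r_def by (intro wf_inv_image wf_lex_prod wf_less_than)
  have rD: "lv i \<le> lv j" if "(i, j) \<in> r" for i j
    using that unfolding r_def by auto
  define before where "before f j q = {i\<in>J. (i, j) \<in> r \<and> f i \<and> R i q}" for f j q
  define step where
    "step f j \<longleftrightarrow> (\<forall>q\<in>K. R j q \<longrightarrow> (\<Sum>\<^sub>\<infinity>i\<in>before f j q. w i) + w j \<le> A * c q)" for f j
  define sel where "sel = wfrec r step"
  have sel: "sel j \<longleftrightarrow> step sel j" for j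
  proof -
    \<comment> \<open>\<open>before\<close> consults predecessors only, so \<open>cut\<close> hides
      nothing from it and \<open>sel\<close> satisfies its recursion equation.\<close>
    have "before (cut sel r j) j q = before sel j q" for q
      unfolding before_def cut_def by auto
    then have "step (cut sel r j) j \<longleftrightarrow> step sel j" unfolding step_def by simp
    moreover have "sel j \<longleftrightarrow> step (cut sel r j) j"
      unfolding sel_def by (simp add: wfrec[OF wfr, of step j])
    ultimately show ?thesis by simp
  qed
  define S where "S = {j\<in>J. sel j}"
  show thesis
  proof (rule that)
    show "S \<subseteq> J" unfolding S_def by auto
    show "(\<Sum>\<^sub>\<infinity>i\<in>{i\<in>S. R i q}. w i) \<le> A * c q" if q: "q \<in> K" for q
    proof (rule infsum_ennreal_leI)
      fix T assume T: "finite T" "T \<subseteq> {i\<in>S. R i q}"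
      show "sum w T \<le> A * c q"
      proof (cases "T = {}")
        case False
        \<comment> \<open>The element \<open>x\<close> found below is the last one of
          \<open>T\<close> in the order \<open>r\<close>, and its own acceptance test bounds the sum
          over all of \<open>T\<close>.\<close>
        define T' where "T' = {y\<in>T. lv y = Max (lv ` T)}"
        have T': "finite T'" "T' \<noteq> {}"
        proof -
          have "Max (lv ` T) \<in> lv ` T" using T(1) False by (intro Max_in) auto
          then show "T' \<noteq> {}" unfolding T'_def by auto
        qed (use T in \<open>simp add: T'_def\<close>)
        then have "Max (to_nat_on J ` T') \<in> to_nat_on J ` T'" by (intro Max_in) auto
        then obtain x where x: "x \<in> T'" "to_nat_on J x = Max (to_nat_on J ` T')" by auto
        have xT: "x \<in> T" "x \<in> J" "sel x" "R x q"
          using x T unfolding T'_def S_def by auto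
        have "(i, x) \<in> r" if i: "i \<in> T - {x}" for i
        proof (cases "i \<in> T'")
          case True
          then have "to_nat_on J i \<le> to_nat_on J x" using x T' by auto
          moreover have "to_nat_on J i \<noteq> to_nat_on J x"
            using inj_onD[OF inj_on_to_nat_on[OF cnt]] i xT T unfolding S_def by blast
          ultimately show ?thesis using True x unfolding r_def T'_def by auto
        next
          case False
          have "lv i \<le> Max (lv ` T)" using i T by auto
          then show ?thesis using False x i unfolding r_def T'_def by auto
        qed
        then have "T - {x} \<subseteq> before sel x q"
          using T unfolding before_def S_def by auto
        then have "sum w (T - {x}) \<le> (\<Sum>\<^sub>\<infinity>i\<in>before sel x q. w i)"
          using T by (intro sum_le_infsum_ennreal) auto
        then have "sum w T \<le> (\<Sum>\<^sub>\<infinity>i\<in>before sel x q. w i) + w x"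
          using sum.remove[OF T(1) xT(1), of w] by (simp add: add.commute add_left_mono)
        also have "\<dots> \<le> A * c q"
          using sel[of x] xT q unfolding step_def by auto
        finally show ?thesis .
      qed simp
    qed
    show "\<exists>q\<in>K. R j q \<and> c q \<le> 3 * (\<Sum>\<^sub>\<infinity>i\<in>{i\<in>S. R i q}. w i)" if j: "j \<in> J - S" for j
    proof -
      have "\<not> step sel j" using j sel unfolding S_def by auto
      then obtain q where q: "q \<in> K" "R j q"
        and less: "A * c q < (\<Sum>\<^sub>\<infinity>i\<in>before sel j q. w i) + w j"
        unfolding step_def by (auto simp: not_le)
      let ?\<sigma> = "\<Sum>\<^sub>\<infinity>i\<in>before sel j q. w i"
      have cq: "c q < ?\<sigma> + w j"
        using less mult_right_mono[OF A, of "c q"] by (simp add: order.strict_trans1)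
      \<comment> \<open>Had nothing been accepted before \<open>j\<close> in \<open>q\<close>, then
        \<open>c q < w j\<close>, against \<open>dom\<close>. So some accepted \<open>i\<close>
        precedes \<open>j\<close>, and \<open>w j \<le> 2 * w i\<close> gives the constant 3 = 1 +
        2.\<close>
      have "before sel j q \<noteq> {}"
        using cq dom[of j q] j q by auto
      then obtain i where i: "i \<in> before sel j q" by auto
      then have "w j \<le> 2 * w i"
        using comparable[of i j] rD j unfolding before_def by auto
      also have "w i \<le> ?\<sigma>"
        using sum_le_infsum_ennreal[of "{i}" _ w] i by auto
      then have "2 * w i \<le> 2 * ?\<sigma>" by (intro mult_left_mono) auto
      finally have "?\<sigma> + w j \<le> ?\<sigma> + 2 * ?\<sigma>" by (rule add_left_mono)
      also have "\<dots> = 3 * ?\<sigma>" using distrib_right[of 1 2 ?\<sigma>] by simp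
      also have "\<dots> \<le> 3 * (\<Sum>\<^sub>\<infinity>i\<in>{i\<in>S. R i q}. w i)"
        by (intro mult_left_mono infsum_mono_set_ennreal) (auto simp: before_def S_def)
      finally have "c q \<le> 3 * (\<Sum>\<^sub>\<infinity>i\<in>{i\<in>S. R i q}. w i)"
        using cq by (auto intro: order.trans less_imp_le)
      then show ?thesis using q by blast
    qed
  qed
qed

section \<open>Dyadic cubes\<close>

locale dyadic_grid =
  fixes xQ :: "real ^ 'n" and l :: real
  assumes l_pos: "0 < l"
begin

definition side :: "int \<Rightarrow> real" where
  "side k = 2 powi k * l"

text \<open>The floor form gives each point exactly one cube per level and turns nestedness into a
  fact about integer division.\<close>

definition cube :: "int \<times> (int ^ 'n) \<Rightarrow> (real ^ 'n) set" where
  "cube p = {y. \<forall>i. \<lfloor>(y $ i - xQ $ i) / side (fst p)\<rfloor> = snd p $ i}"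

lemma side_pos: "0 < side k"
  unfolding side_def using l_pos by simp

lemma side_0: "side 0 = l"
  by (simp add: side_def)

lemma side_add: "side (k + int j) = 2 ^ j * side k"
  unfolding side_def by (simp add: power_int_add)

lemma side_mono: "k \<le> k' \<Longrightarrow> side k \<le> side k'"
  unfolding side_def using l_pos by (simp add: power_int_increasing)

lemma mem_cube_iff:
  "y \<in> cube (k, m) \<longleftrightarrow>
    (\<forall>i. xQ $ i + side k * m $ i \<le> y $ i \<and> y $ i < xQ $ i + side k * (m $ i + 1))"
proof -
  have "\<lfloor>(y $ i - xQ $ i) / side k\<rfloor> = m $ i \<longleftrightarrow>
      xQ $ i + side k * m $ i \<le> y $ i \<and> y $ i < xQ $ i + side k * (m $ i + 1)" for i
    using side_pos[of k] by (simp add: floor_eq_iff field_simps)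
  then show ?thesis unfolding cube_def by simp
qed

lemma dyadic_cubes0_eq: "dyadic_cubes0 xQ l = range cube"
proof -
  have "{xQ + (2 powi k * l) *\<^sub>R ((\<chi> i. real_of_int (m $ i)) + z) | z. \<forall>i. z $ i \<in> {0..<1}}
      = cube (k, m)" (is "?A = _") for k m
  proof (intro set_eqI iffI)
    fix y assume "y \<in> ?A"
    then obtain z where z: "y = xQ + side k *\<^sub>R ((\<chi> i. real_of_int (m $ i)) + z)"
      "\<forall>i. z $ i \<in> {0..<1}" unfolding side_def by blast
    show "y \<in> cube (k, m)"
      unfolding mem_cube_iff z(1) using z(2) side_pos[of k] by (auto simp: mult_left_mono)
  next
    fix y assume y: "y \<in> cube (k, m)"
    define z :: "real ^ 'n" where "z = (\<chi> i. (y $ i - xQ $ i) / side k - m $ i)"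
    have "y = xQ + side k *\<^sub>R ((\<chi> i. real_of_int (m $ i)) + z)"
      using side_pos[of k] by (simp add: vec_eq_iff z_def field_simps)
    moreover have "\<forall>i. z $ i \<in> {0..<1}"
      using y side_pos[of k] unfolding mem_cube_iff z_def by (auto simp: field_simps)
    ultimately show "y \<in> ?A" unfolding side_def by blast
  qed
  then show ?thesis unfolding dyadic_cubes0_def by force
qed

lemma cube_in_dyadic_cubes: "cube p \<in> dyadic_cubes xQ l"
  unfolding dyadic_cubes_def dyadic_cubes0_eq by simp

lemma ex_cube: "\<exists>m. y \<in> cube (k, m)"
  by (rule exI[of _ "\<chi> i. \<lfloor>(y $ i - xQ $ i) / side k\<rfloor>"]) (simp add: cube_def)

text \<open>The index at the coarser level is the integer quotient of the finer index by a power of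
  2, so points with the same fine index share the coarse one.\<close>

lemma cube_nested:
  assumes "y \<in> cube (k, m)" "y \<in> cube (k', m')" "k \<le> k'"
  shows "cube (k, m) \<subseteq> cube (k', m')"
proof -
  obtain j where j: "k' = k + int j" using assms(3) zle_iff_zadd by auto
  have fl: "\<lfloor>t / side k'\<rfloor> = \<lfloor>t / side k\<rfloor> div 2 ^ j" for t
  proof -
    have "t / side k' = (t / side k) / real_of_int (2 ^ j)"
      unfolding j side_add by simp
    then show ?thesis by (simp only: floor_divide_real_eq_div[of "2 ^ j"] zero_le_power zero_le_numeral)
  qed
  show ?thesis using assms(1,2) unfolding cube_def by (auto simp: fl)
qed

lemma cube_same_level:
  assumes "y \<in> cube (k, m)" "y \<in> cube (k, m')"
  shows "m = m'"
  using assms unfolding cube_def by (auto simp: vec_eq_iff)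

lemma abs_component_cube:
  assumes "y \<in> cube (k, m)" "z \<in> cube (k, m)"
  shows "\<bar>y $ i - z $ i\<bar> < side k"
proof -
  have "xQ $ i + side k * m $ i \<le> y $ i" "y $ i < xQ $ i + side k * m $ i + side k"
    "xQ $ i + side k * m $ i \<le> z $ i" "z $ i < xQ $ i + side k * m $ i + side k"
    using assms unfolding mem_cube_iff by (auto simp: algebra_simps)
  then show ?thesis by linarith
qed

lemma dist_le_components:
  fixes y z :: "real ^ 'n"
  assumes "\<And>i. \<bar>y $ i - z $ i\<bar> \<le> t"
  shows "dist y z \<le> real CARD('n) * t"
proof -
  have "dist y z \<le> (\<Sum>i\<in>UNIV. \<bar>(y - z) $ i\<bar>)"
    unfolding dist_norm by (rule norm_le_l1_cart)
  also have "\<dots> \<le> (\<Sum>i\<in>(UNIV :: 'n set). t)"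
    by (rule sum_mono) (use assms in simp)
  finally show ?thesis by simp
qed

lemma dist_cube:
  assumes "y \<in> cube (k, m)" "z \<in> cube (k, m)"
  shows "dist y z \<le> real CARD('n) * side k"
  by (rule dist_le_components) (use abs_component_cube[OF assms] in \<open>simp add: less_imp_le\<close>)

definition centre :: "int \<times> (int ^ 'n) \<Rightarrow> real ^ 'n" where
  "centre p = (\<chi> i. xQ $ i + side (fst p) * (snd p $ i + 1 / 2))"

lemma ball_centre_subset: "ball (centre (k, m)) (side k / 2) \<subseteq> cube (k, m)"
proof
  fix y assume "y \<in> ball (centre (k, m)) (side k / 2)"
  then have "\<bar>(y - centre (k, m)) $ i\<bar> < side k / 2" for i
    using component_le_norm_cart[of "y - centre (k, m)" i]
    by (simp add: dist_norm norm_minus_commute)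
  then have h: "\<bar>y $ i - xQ $ i - side k * m $ i - side k / 2\<bar> < side k / 2" for i
    by (simp add: centre_def algebra_simps)
  have "xQ $ i + side k * m $ i \<le> y $ i \<and> y $ i < xQ $ i + side k * m $ i + side k" for i
    using h[of i] unfolding abs_less_iff by linarith
  then show "y \<in> cube (k, m)"
    unfolding mem_cube_iff by (simp add: algebra_simps)
qed

lemma centre_in_cube: "centre (k, m) \<in> cube (k, m)"
  using ball_centre_subset side_pos[of k] by (meson centre_in_ball half_gt_zero subsetD)

text \<open>For reasons of size the two hypotheses cannot hold together; equality follows from
  nestedness without any comparison of sizes, and is all that the covering argument asks
  for.\<close>

lemma cube_subset_level:
  assumes "cube (k, m) \<subseteq> cube (k', m')" "k' < k"
  shows "cube (k, m) = cube (k', m')"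
  using assms cube_nested[of "centre (k, m)" k' m' k m] centre_in_cube by fastforce

section \<open>Maximal cubes of a family\<close>

definition tops :: "(int \<times> (int ^ 'n)) set \<Rightarrow> (int \<times> (int ^ 'n)) set" where
  "tops F = {p \<in> F. \<forall>q\<in>F. cube p \<inter> cube q \<noteq> {} \<longrightarrow> fst q \<le> fst p}"

text \<open>\<open>tops\<close> compares the levels of cubes that meet. Two tops that meet thus have
  equal levels, and cubes of one level that meet coincide.\<close>

lemma tops_disjoint:
  assumes "p \<in> tops F" "q \<in> tops F" "p \<noteq> q"
  shows "cube p \<inter> cube q = {}"
proof (rule ccontr)
  assume ne: "cube p \<inter> cube q \<noteq> {}"
  then have "fst p = fst q"
    using assms unfolding tops_def by (simp add: Int_commute order.antisym)
  then show False
    using ne assms(3) cube_same_level[of _ "fst p" "snd p" "snd q"]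
    by (metis disjoint_iff prod.collapse prod_eq_iff)
qed

text \<open>Only finitely many levels lie between that of \<open>p\<close> and \<open>N\<close>, so
  among the members of \<open>F\<close> meeting \<open>p\<close> there is a highest one. Anything
  higher that meets it would contain it, and so would meet \<open>p\<close> too.\<close>

lemma ex_tops:
  assumes "p \<in> F" and "\<And>q. q \<in> F \<Longrightarrow> fst q \<le> N"
  obtains q where "q \<in> tops F" "fst p \<le> fst q" "cube p \<subseteq> cube q"
proof -
  define L where "L = fst ` {q \<in> F. fst p \<le> fst q \<and> cube p \<inter> cube q \<noteq> {}}"
  have "L \<subseteq> {fst p..N}" unfolding L_def using assms(2) by auto
  then have fin: "finite L" by (rule finite_subset) auto
  have "fst p \<in> L"
    unfolding L_def using assms(1) centre_in_cube[of "fst p" "snd p"] by (intro imageI) auto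
  then obtain M where M: "M \<in> L" "\<And>k. k \<in> L \<Longrightarrow> k \<le> M"
    using fin Max_in Max_ge by (metis empty_iff)
  from M(1) obtain q where q: "q \<in> F" "fst q = M" "fst p \<le> fst q" "cube p \<inter> cube q \<noteq> {}"
    unfolding L_def by auto
  have nest: "cube p \<subseteq> cube q"
    using q(3,4) cube_nested[of _ "fst p" "snd p" "fst q" "snd q"] by auto
  have "fst q' \<le> fst q" if q': "q' \<in> F" "cube q \<inter> cube q' \<noteq> {}" for q'
  proof (rule ccontr)
    assume less: "\<not> fst q' \<le> fst q"
    then have "cube q \<subseteq> cube q'"
      using q'(2) cube_nested[of _ "fst q" "snd q" "fst q'" "snd q'"] by auto
    then have "cube p \<inter> cube q' \<noteq> {}"
      using nest centre_in_cube[of "fst p" "snd p"] by auto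
    then have "fst q' \<in> L" unfolding L_def using q' q(3) less by (intro imageI) auto
    then show False using less q(2) M(2) by auto
  qed
  then have "q \<in> tops F" unfolding tops_def using q by auto
  then show thesis using that q nest by blast
qed

lemma inj_on_cube_tops: "inj_on cube (tops F)"
proof (rule inj_onI)
  fix p q assume "p \<in> tops F" "q \<in> tops F" "cube p = cube q"
  then show "p = q"
    using tops_disjoint[of p F q] centre_in_cube[of "fst p" "snd p"] by auto
qed

lemma non_overlapping_tops: "non_overlapping (cube ` tops F)"
  unfolding non_overlapping_def pairwise_def
proof (intro ballI impI)
  fix P R assume "P \<in> cube ` tops F" "R \<in> cube ` tops F" "P \<noteq> R"
  then have "P \<inter> R = {}" using tops_disjoint by blast
  then show "interior P \<inter> interior R = {}"
    using interior_subset[of P] interior_subset[of R] by blast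
qed

section \<open>Covering balls by neighbouring cubes, and the choice of scale\<close>

definition neighbours :: "(int ^ 'n) set" where
  "neighbours = {v. \<forall>i. v $ i \<in> {-1..1}}"

lemma finite_neighbours: "finite neighbours"
proof -
  have "neighbours \<subseteq> (\<lambda>f. \<chi> i. f i) ` (UNIV \<rightarrow>\<^sub>E {-1..1})"
  proof
    fix v :: "int ^ 'n" assume "v \<in> neighbours"
    then show "v \<in> (\<lambda>f. \<chi> i. f i) ` (UNIV \<rightarrow>\<^sub>E {-1..1})"
      unfolding neighbours_def
      by (intro image_eqI[of v _ "vec_nth v"]) (auto simp: vec_nth_inverse)
  qed
  then show ?thesis by (rule finite_subset) (intro finite_imageI finite_PiE, auto)
qed

text \<open>In each coordinate the quotients by \<open>side k\<close> differ by less than 1, so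
  their floors differ by at most 1.\<close>

lemma ball_subset_neighbours:
  assumes "x \<in> cube (k, m)" "r \<le> side k"
  shows "ball x r \<subseteq> (\<Union>v\<in>neighbours. cube (k, m + v))"
proof
  fix y assume y: "y \<in> ball x r"
  obtain m' where m': "y \<in> cube (k, m')" using ex_cube by blast
  have "(m' - m) $ i \<in> {-1..1}" for i
  proof -
    have "\<bar>y $ i - x $ i\<bar> < side k"
      using component_le_norm_cart[of "y - x" i] y assms(2)
      by (simp add: dist_norm norm_minus_commute)
    moreover have "\<bar>(y $ i - xQ $ i) / side k - (x $ i - xQ $ i) / side k\<bar>
        = \<bar>y $ i - x $ i\<bar> / side k"
      using side_pos[of k] by (simp flip: diff_divide_distrib)
    ultimately have "\<bar>(y $ i - xQ $ i) / side k - (x $ i - xQ $ i) / side k\<bar> < 1"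
      using side_pos[of k] by simp
    moreover have "\<lfloor>(y $ i - xQ $ i) / side k\<rfloor> = m' $ i" "\<lfloor>(x $ i - xQ $ i) / side k\<rfloor> = m $ i"
      using m' assms(1) unfolding cube_def by auto
    ultimately show ?thesis by simp linarith
  qed
  then have "m' - m \<in> neighbours" unfolding neighbours_def by auto
  then show "y \<in> (\<Union>v\<in>neighbours. cube (k, m + v))"
    using m' by (intro UN_I[of "m' - m"]) auto
qed

lemma dist_neighbour:
  assumes "x \<in> cube (k, m)" "v \<in> neighbours" "y \<in> cube (k, m + v)"
  shows "dist y x \<le> real CARD('n) * (2 * side k)"
proof (rule dist_le_components)
  fix i
  have "xQ $ i + side k * m $ i \<le> x $ i" "x $ i < xQ $ i + side k * m $ i + side k"
    "xQ $ i + side k * m $ i + side k * v $ i \<le> y $ i"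
    "y $ i < xQ $ i + side k * m $ i + side k * v $ i + side k"
    using assms(1,3) unfolding mem_cube_iff by (auto simp: algebra_simps)
  moreover have "- side k \<le> side k * v $ i" "side k * v $ i \<le> side k"
  proof -
    have "-1 \<le> v $ i" "v $ i \<le> 1" using assms(2) unfolding neighbours_def by auto
    then have "-1 \<le> real_of_int (v $ i)" "real_of_int (v $ i) \<le> 1" by linarith+
    then show "- side k \<le> side k * v $ i" "side k * v $ i \<le> side k"
      using mult_left_mono[of "-1" "real_of_int (v $ i)" "side k"]
        mult_left_mono[of "real_of_int (v $ i)" 1 "side k"] side_pos[of k] by auto
  qed
  ultimately show "\<bar>y $ i - x $ i\<bar> \<le> 2 * side k" by linarith
qed

text \<open>The level is \<open>- j\<close> for the largest natural \<open>j\<close> with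
  \<open>r * 2 ^ j \<le> l\<close>; the hypothesis \<open>r \<le> l\<close> makes such a
  \<open>j\<close> exist.\<close>

lemma ex_level:
  assumes "0 < r" "r \<le> l"
  obtains k where "k \<le> 0" "r \<le> side k" "side k < 2 * r"
proof -
  obtain n where n: "l / r < 2 ^ n" using real_arch_pow[of 2 "l / r"] by auto
  define j where "j = (GREATEST j. r * 2 ^ j \<le> l)"
  have bd: "j \<le> n" if "r * 2 ^ j \<le> l" for j
  proof (rule ccontr)
    assume "\<not> j \<le> n"
    then have "(2::real) ^ n \<le> 2 ^ j" by (intro power_increasing) auto
    then have "r * 2 ^ n \<le> r * 2 ^ j" using assms by (intro mult_left_mono) auto
    moreover have "l < r * 2 ^ n" using n assms by (simp add: field_simps)
    ultimately show False using that by linarith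
  qed
  have 1: "r * 2 ^ j \<le> l"
    unfolding j_def by (rule GreatestI_nat[of _ 0 n]) (use bd assms in auto)
  have "\<not> r * 2 ^ Suc j \<le> l"
    using Greatest_le_nat[of "\<lambda>j. r * 2 ^ j \<le> l" "Suc j" n] bd unfolding j_def by auto
  then have 2: "l < r * 2 ^ Suc j" by simp
  have s: "side (- int j) = l / 2 ^ j"
    unfolding side_def by (simp add: power_int_minus field_simps)
  show thesis
    by (rule that[of "- int j"]) (use 1 2 in \<open>auto simp: s field_simps\<close>)
qed

lemma ex_large_side: "\<exists>N\<ge>0. t \<le> side N"
proof -
  obtain n where n: "t / l < 2 ^ n" using real_arch_pow[of 2 "t / l"] by auto
  have "t \<le> side (0 + int n)"
    using n l_pos unfolding side_add side_0 by (simp add: field_simps)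
  then show ?thesis by (intro exI[of _ "int n"]) auto
qed

text \<open>The cube is the one of level \<open>k\<close> in the quadrant with \<open>xQ\<close> in
  its closure. At a high level it lets the capacity of the quadrant control that of a ball around
  \<open>xQ\<close>.\<close>

lemma quadrant_contains_cube:
  assumes "q \<in> dyadic_quadrants xQ"
  obtains m where "cube (k, m) \<subseteq> q" "\<And>y. y \<in> cube (k, m) \<Longrightarrow> dist y xQ \<le> real CARD('n) * side k"
proof -
  obtain I where I: "q = {y. \<forall>i. y $ i \<in> I i}" "\<And>i. I i = {xQ $ i..} \<or> I i = {..<xQ $ i}"
    using assms unfolding dyadic_quadrants_def by auto
  define m :: "int ^ 'n" where "m = (\<chi> i. if I i = {xQ $ i..} then 0 else -1)"
  have comp: "y $ i \<in> I i \<and> \<bar>y $ i - xQ $ i\<bar> \<le> side k" if "y \<in> cube (k, m)" for y i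
  proof -
    have "xQ $ i + side k * m $ i \<le> y $ i" "y $ i < xQ $ i + side k * (m $ i + 1)"
      using that unfolding mem_cube_iff by auto
    then show ?thesis
      using I(2)[of i] side_pos[of k] by (cases "I i = {xQ $ i..}") (auto simp: m_def)
  qed
  show thesis
  proof (rule that[of m])
    show "cube (k, m) \<subseteq> q" using comp I(1) by auto
    show "dist y xQ \<le> real CARD('n) * side k" if "y \<in> cube (k, m)" for y
      by (rule dist_le_components) (use comp that in auto)
  qed
qed

end

section \<open>The Choquet integral\<close>

locale outer_cap =
  fixes C :: "(real ^ 'n) set \<Rightarrow> ennreal"
  assumes outer: "outer_capacity C"
begin

lemma cap_empty [simp]: "C {} = 0"
  and cap_mono: "A \<subseteq> B \<Longrightarrow> C A \<le> C B"
  and cap_UN_nat: "A \<subseteq> (\<Union>i. F (i :: nat)) \<Longrightarrow> C A \<le> (\<Sum>i. C (F i))"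
  using outer unfolding outer_capacity_def by blast+

lemma cap_UN:
  fixes B :: "'i :: countable \<Rightarrow> (real ^ 'n) set"
  assumes "A \<subseteq> (\<Union>i\<in>I. B i)"
  shows "C A \<le> (\<Sum>\<^sub>\<infinity>i\<in>I. C (B i))"
proof -
  define F where "F n = (if n \<in> to_nat ` I then B (from_nat n) else {})" for n
  have "A \<subseteq> (\<Union>n. F n)"
  proof
    fix y assume "y \<in> A"
    then obtain i where "i \<in> I" "y \<in> B i" using assms by auto
    then have "y \<in> F (to_nat i)" unfolding F_def by auto
    then show "y \<in> (\<Union>n. F n)" by auto
  qed
  then have "C A \<le> (\<Sum>n. C (F n))" by (rule cap_UN_nat)
  also have "(\<Sum>n. C (F n)) \<le> (\<Sum>\<^sub>\<infinity>i\<in>I. C (B i))"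
  proof (rule suminf_le_const)
    fix n
    have "(\<Sum>i<n. C (F i)) = (\<Sum>i\<in>{..<n} \<inter> to_nat ` I. C (F i))"
      by (rule sum.mono_neutral_right) (auto simp: F_def)
    also have "\<dots> = (\<Sum>i\<in>{i\<in>I. to_nat i < n}. C (B i))"
      by (rule sum.reindex_cong[of to_nat]) (auto simp: F_def)
    also have "\<dots> \<le> (\<Sum>\<^sub>\<infinity>i\<in>I. C (B i))"
    proof (rule sum_le_infsum_ennreal)
      have "to_nat ` {i \<in> I. to_nat i < n} \<subseteq> {..<n}" by auto
      then show "finite {i \<in> I. to_nat i < n}"
        by (meson finite_lessThan finite_subset finite_imageD inj_on_to_nat inj_on_subset subset_UNIV inj_to_nat)
    qed auto
    finally show "(\<Sum>i<n. C (F i)) \<le> (\<Sum>\<^sub>\<infinity>i\<in>I. C (B i))" .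
  qed simp
  finally show ?thesis .
qed

lemma cap_Un: "C (A \<union> B) \<le> C A + C B"
proof -
  have "C (A \<union> B) \<le> (\<Sum>\<^sub>\<infinity>b\<in>UNIV. C (if b then A else B))"
    by (rule cap_UN) auto
  also have "\<dots> = C A + C B" by (simp add: UNIV_bool add.commute)
  finally show ?thesis .
qed

lemma cap_UN_finite:
  assumes "finite V"
  shows "C (\<Union>v\<in>V. B v) \<le> (\<Sum>v\<in>V. C (B v))"
  using assms
proof (induction V rule: finite_induct)
  case (insert v V)
  then show ?case using cap_Un[of "B v" "\<Union>v\<in>V. B v"] by (simp add: add_left_mono order_trans)
qed simp

lemma cap_null_UN:
  assumes "\<And>i :: nat. C (F i) = 0"
  shows "C (\<Union>i. F i) = 0"
  using cap_UN_nat[of "\<Union>i. F i" F] assms by simp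

lemma superlevel_measurable [measurable]:
  "(\<lambda>t. C {x \<in> A. f x > ennreal t}) \<in> borel_measurable borel"
proof (rule borel_measurableI_greater)
  fix a
  have "is_interval {t. a < C {x \<in> A. f x > ennreal t}}"
    unfolding is_interval_1
  proof safe
    fix s t u :: real
    assume "a < C {x \<in> A. ennreal u < f x}" "t \<le> u"
    then show "a < C {x \<in> A. ennreal t < f x}"
      by (elim order.strict_trans2) (auto intro!: cap_mono intro: ennreal_leI order.strict_trans1)
  qed
  then have "{t. a < C {x \<in> A. f x > ennreal t}} \<in> sets borel"
    by (rule real_interval_borel_measurable)
  then show "{t \<in> space borel. a < C {x \<in> A. f x > ennreal t}} \<in> sets borel"
    by simp
qed

abbreviation ch where "ch \<equiv> choquet_integral C"

lemma choquet_mono_levels: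
  assumes "\<And>t. 0 < t \<Longrightarrow> {x \<in> A. ennreal t < f x} \<subseteq> {x \<in> B. ennreal t < g x}"
  shows "ch A f \<le> ch B g"
  unfolding choquet_integral_def
  by (intro nn_integral_mono) (auto simp: indicator_def intro!: cap_mono assms)

lemma choquet_mono:
  assumes "A \<subseteq> B" "\<And>x. x \<in> A \<Longrightarrow> f x \<le> g x"
  shows "ch A f \<le> ch B g"
  by (rule choquet_mono_levels) (use assms in \<open>auto intro: order.strict_trans2\<close>)

text \<open>Each level set splits along the cover, so subadditivity in the domain costs no constant,
  unlike subadditivity in the integrand.\<close>

lemma choquet_UN:
  assumes "finite V" "A \<subseteq> (\<Union>v\<in>V. B v)"
  shows "ch A f \<le> (\<Sum>v\<in>V. ch (B v) f)"
proof -
  have "ch A f \<le> (\<integral>\<^sup>+t. (\<Sum>v\<in>V. C {x \<in> B v. f x > ennreal t} * indicator {0<..} t) \<partial>lborel)"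
    unfolding choquet_integral_def
  proof (rule nn_integral_mono)
    fix t
    have "C {x \<in> A. f x > ennreal t} \<le> C (\<Union>v\<in>V. {x \<in> B v. f x > ennreal t})"
      using assms(2) by (intro cap_mono) auto
    also have "\<dots> \<le> (\<Sum>v\<in>V. C {x \<in> B v. f x > ennreal t})"
      by (rule cap_UN_finite[OF assms(1)])
    finally show "C {x \<in> A. f x > ennreal t} * indicator {0<..} t
        \<le> (\<Sum>v\<in>V. C {x \<in> B v. f x > ennreal t} * indicator {0<..} t)"
      by (auto simp: indicator_def)
  qed
  also have "\<dots> = (\<Sum>v\<in>V. ch (B v) f)"
    unfolding choquet_integral_def by (rule nn_integral_sum) simp
  finally show ?thesis .
qed

lemma choquet_le_const:
  assumes "0 \<le> c" "\<And>x. x \<in> A \<Longrightarrow> f x \<le> ennreal c"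
  shows "ch A f \<le> ennreal c * C A"
proof -
  have "ch A f \<le> (\<integral>\<^sup>+t. C A * indicator {0<..c} t \<partial>lborel)"
    unfolding choquet_integral_def
  proof (rule nn_integral_mono)
    fix t
    have "{x \<in> A. f x > ennreal t} = {}" if "c < t"
      using assms that by (force dest: order.strict_trans2 simp: ennreal_less_iff)
    then have "C {x \<in> A. f x > ennreal t} = 0" if "c < t" using that by (metis cap_empty)
    then show "C {x \<in> A. f x > ennreal t} * indicator {0<..} t \<le> C A * indicator {0<..c} t"
      by (cases "c < t") (auto simp: indicator_def intro!: cap_mono)
  qed
  also have "\<dots> = ennreal c * C A"
    using assms(1) by (subst nn_integral_cmult_indicator) (auto simp: mult.commute)
  finally show ?thesis .
qed

lemma choquet_half_levels:
  "(\<integral>\<^sup>+t. C {x \<in> A. f x > ennreal (t / 2)} * indicator {0<..} t \<partial>lborel) = 2 * ch A f"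
proof -
  have "(\<integral>\<^sup>+t. C {x \<in> A. f x > ennreal (t / 2)} * indicator {0<..} t \<partial>lborel)
      = ennreal \<bar>2\<bar> * (\<integral>\<^sup>+t. C {x \<in> A. f x > ennreal ((0 + 2 * t) / 2)} * indicator {0<..} (0 + 2 * t) \<partial>lborel)"
  proof (rule nn_integral_real_affine)
    have "(\<lambda>t. C {x \<in> A. f x > ennreal t}) \<circ> (\<lambda>t. t / 2) \<in> borel_measurable borel"
      by (intro measurable_comp[OF _ superlevel_measurable]) simp
    then have [measurable]: "(\<lambda>t. C {x \<in> A. f x > ennreal (t / 2)}) \<in> borel_measurable borel"
      by (simp add: comp_def)
    show "(\<lambda>t. C {x \<in> A. f x > ennreal (t / 2)} * indicator {0<..} t) \<in> borel_measurable borel"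
      by simp
  qed simp
  also have "\<dots> = 2 * ch A f"
    unfolding choquet_integral_def by (simp add: indicator_def)
  finally show ?thesis .
qed

text \<open>The Choquet integral is subadditive only up to a constant, since \<open>C\<close> is not assumed to be
  strongly subadditive.\<close>

lemma choquet_add_le:
  assumes "\<And>x. x \<in> A \<Longrightarrow> f x \<le> g x + h x"
  shows "ch A f \<le> 2 * ch A g + 2 * ch A h"
proof -
  have [measurable]: "(\<lambda>t. C {x \<in> A. k x > ennreal (t / 2)}) \<in> borel_measurable borel" for k
  proof -
    have "(\<lambda>t. C {x \<in> A. k x > ennreal t}) \<circ> (\<lambda>t. t / 2) \<in> borel_measurable borel"
      by (intro measurable_comp[OF _ superlevel_measurable]) simp
    then show ?thesis by (simp add: comp_def)
  qed
  have "ch A f \<le> (\<integral>\<^sup>+t. C {x \<in> A. g x > ennreal (t / 2)} * indicator {0<..} t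
      + C {x \<in> A. h x > ennreal (t / 2)} * indicator {0<..} t \<partial>lborel)"
    unfolding choquet_integral_def
  proof (rule nn_integral_mono)
    fix t :: real
    have "{x \<in> A. f x > ennreal t}
        \<subseteq> {x \<in> A. g x > ennreal (t / 2)} \<union> {x \<in> A. h x > ennreal (t / 2)}" if "0 < t"
    proof
      fix x assume x: "x \<in> {x \<in> A. f x > ennreal t}"
      show "x \<in> {x \<in> A. g x > ennreal (t / 2)} \<union> {x \<in> A. h x > ennreal (t / 2)}"
      proof (rule ccontr)
        assume "x \<notin> {x \<in> A. g x > ennreal (t / 2)} \<union> {x \<in> A. h x > ennreal (t / 2)}"
        then have "g x + h x \<le> ennreal (t / 2) + ennreal (t / 2)"
          using x by (intro add_mono) (auto simp: not_less)
        also have "\<dots> = ennreal t" using that by (simp flip: ennreal_plus)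
        finally show False using assms[of x] x by (auto dest: order.strict_trans2)
      qed
    qed
    then have "C {x \<in> A. f x > ennreal t}
        \<le> C {x \<in> A. g x > ennreal (t / 2)} + C {x \<in> A. h x > ennreal (t / 2)}" if "0 < t"
      using cap_Un cap_mono order_trans that by meson
    then show "C {x \<in> A. f x > ennreal t} * indicator {0<..} t
      \<le> C {x \<in> A. g x > ennreal (t / 2)} * indicator {0<..} t
        + C {x \<in> A. h x > ennreal (t / 2)} * indicator {0<..} t"
      by (auto simp: indicator_def)
  qed
  also have "\<dots> = 2 * ch A g + 2 * ch A h"
    by (subst nn_integral_add) (simp_all add: choquet_half_levels)
  finally show ?thesis .
qed

lemma choquet_Markov:
  assumes "0 \<le> c"
  shows "ennreal c * C {x \<in> A. ennreal c < f x} \<le> ch A f"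
proof -
  have "ennreal c * C {x \<in> A. ennreal c < f x}
      = (\<integral>\<^sup>+t. C {x \<in> A. ennreal c < f x} * indicator {0<..c} t \<partial>lborel)"
    using assms by (subst nn_integral_cmult_indicator) (auto simp: mult.commute)
  also have "\<dots> \<le> ch A f"
    unfolding choquet_integral_def
    by (intro nn_integral_mono)
      (auto simp: indicator_def intro!: cap_mono intro: ennreal_leI order.strict_trans1)
  finally show ?thesis .
qed

section \<open>Approximation by continuous functions\<close>

lemma choquet_tail:
  assumes "ch UNIV (\<lambda>x. ennreal \<bar>f x\<bar>) < \<infinity>" "0 < e"
  obtains N :: nat where "ch UNIV (\<lambda>x. ennreal (\<bar>f x\<bar> - N)) < e"
proof -
  define \<phi> where "\<phi> t = C {x \<in> UNIV. ennreal \<bar>f x\<bar> > ennreal t}" for t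
  have [measurable]: "\<phi> \<in> borel_measurable borel"
    unfolding \<phi>_def by (rule superlevel_measurable)
  define g where "g N t = \<phi> t * indicator {real N<..} t" for N t
  \<comment> \<open>\<open>ennreal\<close> sends negative numbers to 0, so the integrand is the
    excess of \<open>\<bar>f x\<bar>\<close> over \<open>N\<close>. Shifting the levels by
    \<open>N\<close> makes its integral the tail of a convergent integral.\<close>
  have eq: "ch UNIV (\<lambda>x. ennreal (\<bar>f x\<bar> - N)) = (\<integral>\<^sup>+t. g N t \<partial>lborel)" for N :: nat
  proof -
    have "(\<integral>\<^sup>+t. g N t \<partial>lborel) = ennreal \<bar>1\<bar> * (\<integral>\<^sup>+t. g N (N + 1 * t) \<partial>lborel)"
      by (rule nn_integral_real_affine) (auto simp: g_def)
    also have "\<dots> = (\<integral>\<^sup>+t. \<phi> (N + t) * indicator {0<..} t \<partial>lborel)"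
      by (simp add: g_def indicator_def)
    also have "\<dots> = ch UNIV (\<lambda>x. ennreal (\<bar>f x\<bar> - N))"
      unfolding choquet_integral_def \<phi>_def
    proof (rule nn_integral_cong)
      fix t :: real
      have "{x \<in> UNIV. ennreal (N + t) < ennreal \<bar>f x\<bar>} = {x \<in> UNIV. ennreal t < ennreal (\<bar>f x\<bar> - N)}"
        if "0 < t"
        using that by (auto simp: ennreal_less_iff simp del: ennreal_plus)
      then show "C {x \<in> UNIV. ennreal (N + t) < ennreal \<bar>f x\<bar>} * indicator {0<..} t
          = C {x \<in> UNIV. ennreal t < ennreal (\<bar>f x\<bar> - N)} * indicator {0<..} t"
        by (auto simp: indicator_def)
    qed
    finally show ?thesis by simp
  qed
  have "(INF N. \<integral>\<^sup>+t. g N t \<partial>lborel) = (\<integral>\<^sup>+t. (INF N. g N t) \<partial>lborel)"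
  proof (rule nn_integral_monotone_convergence_INF_decseq[symmetric, where i = 0])
    show "decseq g"
      by (intro decseq_SucI) (auto simp: le_fun_def g_def indicator_def)
    show "(\<integral>\<^sup>+t. g 0 t \<partial>lborel) < \<infinity>"
      using assms(1) eq[of 0] by simp
  qed (simp add: g_def)
  also have "\<dots> = (\<integral>\<^sup>+t. 0 \<partial>(lborel :: real measure))"
  proof (rule nn_integral_cong)
    fix t :: real
    obtain N :: nat where "t < N" using reals_Archimedean2 by blast
    then have "g N t = 0" by (simp add: g_def)
    then have "(INF N. g N t) \<le> 0" by (metis INF_lower UNIV_I)
    then show "(INF N. g N t) = 0" by simp
  qed
  finally have "(INF N. \<integral>\<^sup>+t. g N t \<partial>lborel) < e" using assms(2) by simp
  then obtain N where "(\<integral>\<^sup>+t. g N t \<partial>lborel) < e" by (auto simp: INF_less_iff)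
  then show thesis using that[of N] eq[of N] by simp
qed

text \<open>Truncation comes first: on the exceptional open set the error is then at most 2N, and
  its integral at most 2N times the capacity of that set, which is chosen after N.\<close>

lemma continuous_approximation:
  assumes f: "f \<in> L1_capacity C" and e: "0 < e"
  obtains g where "continuous_on UNIV g" "ch UNIV (\<lambda>x. ennreal \<bar>f x - g x\<bar>) < ennreal e"
proof -
  obtain N :: nat where N: "ch UNIV (\<lambda>x. ennreal (\<bar>f x\<bar> - N)) < ennreal (e / 8)"
    using choquet_tail[of f "ennreal (e / 8)"] f e unfolding L1_capacity_def by auto
  \<comment> \<open>This makes 2 N d at most e / 8. Both errors are then at most e / 8, and the
    factor 2 in \<open>choquet_add_le\<close> leaves e / 2 in total.\<close>
  define d where "d = e / (16 * (real N + 1))"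
  have d: "0 < d" unfolding d_def using e by simp
  then obtain U where U: "open U" "C U < ennreal d" "continuous_on (- U) f"
    using f unfolding L1_capacity_def quasicontinuous_def by blast
  define fN where "fN x = max (- real N) (min (real N) (f x))" for x
  have "continuous_on (- U) fN"
    unfolding fN_def by (intro continuous_intros U)
  moreover have "closedin (top_of_set UNIV) (- U)" using U(1) by auto
  ultimately obtain g where g: "continuous_on UNIV g" "\<And>x. x \<in> - U \<Longrightarrow> g x = fN x"
    "\<And>x. x \<in> UNIV \<Longrightarrow> norm (g x) \<le> real N"
  proof (rule Tietze[where B = "real N"])
    show "norm (fN x) \<le> real N" for x unfolding fN_def by auto
  qed auto
  have "ch UNIV (\<lambda>x. ennreal \<bar>fN x - g x\<bar>) \<le> ch U (\<lambda>x. ennreal \<bar>fN x - g x\<bar>)"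
    by (rule choquet_mono_levels) (use g(2) in force)
  also have "\<dots> \<le> ennreal (2 * real N) * C U"
  proof (rule choquet_le_const)
    show "ennreal \<bar>fN x - g x\<bar> \<le> ennreal (2 * real N)" for x
      using g(3)[of x] by (intro ennreal_leI) (auto simp: fN_def)
  qed simp
  also have "\<dots> \<le> ennreal (2 * real N) * ennreal d"
    using U by (intro mult_left_mono) auto
  also have "\<dots> = ennreal (2 * real N * d)" using d by (simp add: ennreal_mult)
  also have "\<dots> \<le> ennreal (e / 8)"
    using e by (intro ennreal_leI) (simp add: d_def field_simps)
  finally have 1: "ch UNIV (\<lambda>x. ennreal \<bar>fN x - g x\<bar>) \<le> ennreal (e / 8)" .
  have "ch UNIV (\<lambda>x. ennreal \<bar>f x - g x\<bar>)
      \<le> 2 * ch UNIV (\<lambda>x. ennreal (\<bar>f x\<bar> - N)) + 2 * ch UNIV (\<lambda>x. ennreal \<bar>fN x - g x\<bar>)"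
  proof (rule choquet_add_le)
    fix x
    have "\<bar>f x - g x\<bar> \<le> max 0 (\<bar>f x\<bar> - N) + \<bar>fN x - g x\<bar>" unfolding fN_def by auto
    then have "ennreal \<bar>f x - g x\<bar> \<le> ennreal (max 0 (\<bar>f x\<bar> - N)) + ennreal \<bar>fN x - g x\<bar>"
      by (simp flip: ennreal_plus add: ennreal_leI)
    then show "ennreal \<bar>f x - g x\<bar> \<le> ennreal (\<bar>f x\<bar> - N) + ennreal \<bar>fN x - g x\<bar>"
      by (simp add: max_def ennreal_neg split: if_splits)
  qed
  also have "\<dots> \<le> 2 * ennreal (e / 8) + 2 * ennreal (e / 8)"
    using N 1 by (intro add_mono mult_left_mono) auto
  also have "\<dots> = ennreal (e / 2)"
  proof -
    have "2 * ennreal (e / 8) = ennreal (e / 4)"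
      using e ennreal_mult[of 2 "e / 8"] by simp
    then show ?thesis using e ennreal_plus[of "e / 4" "e / 4"] by simp
  qed
  also have "\<dots> < ennreal e" using e by (intro ennreal_lessI) auto
  finally show thesis by (rule that[OF g(1)])
qed

end

section \<open>The weak-type estimate\<close>

lemma (in outer_cap) double_power:
  assumes D: "0 < D" and double: "\<And>x r. 0 < r \<Longrightarrow> C (ball x (2 * r)) \<le> ennreal D * C (ball x r)"
    and r: "0 < r"
  shows "C (ball x (2 ^ j * r)) \<le> ennreal (D ^ j) * C (ball x r)"
proof (induction j)
  case (Suc j)
  have "C (ball x (2 ^ Suc j * r)) \<le> ennreal D * C (ball x (2 ^ j * r))"
    using double[of "2 ^ j * r" x] r by (simp add: mult.assoc)
  also have "\<dots> \<le> ennreal D * (ennreal (D ^ j) * C (ball x r))"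
    by (rule mult_left_mono[OF Suc]) simp
  also have "\<dots> = ennreal (D ^ Suc j) * C (ball x r)"
    using D by (simp add: ennreal_mult mult.assoc)
  finally show ?case .
qed simp

text \<open>The greedy selection asks for positive weights below a finite bound; the two assumptions
  on balls supply these.\<close>

locale doubling_cap = outer_cap C + dyadic_grid xQ l
  for C :: "(real ^ 'n) set \<Rightarrow> ennreal" and xQ :: "real ^ 'n" and l :: real +
  fixes D :: real
  assumes D_pos: "0 < D"
    and double: "\<And>x r. 0 < r \<Longrightarrow> C (ball x (2 * r)) \<le> ennreal D * C (ball x r)"
    and ball_pos: "\<And>x r. 0 < r \<Longrightarrow> 0 < C (ball x r)"
    and ball_fin: "\<And>x r. C (ball x r) < \<infinity>"
begin

section \<open>Comparing balls and cubes by doubling\<close>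

lemma ball_scale:
  obtains K where "0 < K" "\<And>x r. 0 < r \<Longrightarrow> C (ball x (T * r)) \<le> ennreal K * C (ball x r)"
proof -
  obtain j where j: "T < 2 ^ j" using real_arch_pow[of 2 T] by auto
  show thesis
  proof (rule that)
    show "0 < D ^ j" using D_pos by simp
    fix x r assume r: "(0::real) < r"
    have "C (ball x (T * r)) \<le> C (ball x (2 ^ j * r))"
      by (intro cap_mono subset_ball mult_right_mono) (use j r in auto)
    also have "\<dots> \<le> ennreal (D ^ j) * C (ball x r)" by (rule double_power[OF D_pos double r])
    finally show "C (ball x (T * r)) \<le> ennreal (D ^ j) * C (ball x r)" .
  qed
qed

text \<open>The cube contains the ball about its centre with half its side as radius. That ball,
  inflated by \<open>2 * (T + real CARD('n))\<close>, covers the ball about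
  \<open>y\<close>.\<close>

lemma cube_scale:
  obtains K where "0 < K"
    "\<And>p y. y \<in> cube p \<Longrightarrow> C (ball y (T * side (fst p))) \<le> ennreal K * C (cube p)"
proof -
  obtain K where K: "0 < K"
    "\<And>x r. 0 < r \<Longrightarrow> C (ball x ((2 * (T + real CARD('n))) * r)) \<le> ennreal K * C (ball x r)"
    using ball_scale by blast
  have "C (ball y (T * side (fst p))) \<le> ennreal K * C (cube p)" if y: "y \<in> cube p" for y p
  proof -
    obtain k m where p: "p = (k, m)" by force
    have "dist y (centre p) \<le> real CARD('n) * side k"
      using dist_cube[of y k m] y centre_in_cube[of k m] p by simp
    then have "ball y (T * side (fst p)) \<subseteq> ball (centre p) ((2 * (T + real CARD('n))) * (side k / 2))"
      by (intro ball_subset_ball_iff[THEN iffD2]) (simp add: p algebra_simps)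
    then have "C (ball y (T * side (fst p))) \<le> C (ball (centre p) ((2 * (T + real CARD('n))) * (side k / 2)))"
      by (rule cap_mono)
    also have "\<dots> \<le> ennreal K * C (ball (centre p) (side k / 2))"
      by (rule K(2)) (use side_pos in simp)
    also have "\<dots> \<le> ennreal K * C (cube p)"
      unfolding p by (intro mult_left_mono cap_mono ball_centre_subset) simp
    finally show ?thesis .
  qed
  then show thesis using that K(1) by blast
qed

lemma cube_pos: "0 < C (cube p)"
proof -
  obtain k m where p: "p = (k, m)" by force
  have "0 < C (ball (centre p) (side k / 2))" by (rule ball_pos) (use side_pos in simp)
  also have "\<dots> \<le> C (cube p)" unfolding p by (intro cap_mono ball_centre_subset)
  finally show ?thesis .
qed

text \<open>A rejected cube lies in a member \<open>q\<close> of the grid whose capacity is controlled by the selected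
  cubes inside \<open>q\<close>. If \<open>q\<close> is a quadrant or a very large cube, then already the whole ball around
  \<open>xQ\<close> is controlled by \<open>q\<close>; the localisation to this ball is what disposes of the quadrants, as
  \<open>C\<close> need not be continuous along increasing sequences. Otherwise the maximal \<open>q\<close> are used.\<close>

lemma packed_covering:
  obtains K where "0 < K"
    "\<And>F R A. 0 < R \<Longrightarrow> 1 \<le> A \<Longrightarrow> (\<And>p. p \<in> F \<Longrightarrow> fst p \<le> 0 \<and> cube p \<subseteq> ball xQ R) \<Longrightarrow>
      \<exists>S\<subseteq>tops F.
        (\<forall>q\<in>dyadic_cubes xQ l. (\<Sum>\<^sub>\<infinity>i\<in>{i\<in>S. cube i \<subseteq> q}. C (cube i)) \<le> A * C q) \<and>
        C (ball xQ R \<inter> (\<Union>p\<in>tops F. \<Union>y\<in>cube p. ball y (T * side (fst p))))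
          \<le> ennreal K * (\<Sum>\<^sub>\<infinity>i\<in>S. C (cube i))"
proof -
  \<comment> \<open>\<open>CARD('n)\<close> pays for the distance from the centre of a cube to its
    points and \<open>\<bar>T\<bar>\<close> for the dilation; 2 makes room for comparing the ball
    around \<open>xQ\<close> with quadrants and very large cubes.\<close>
  define T1 where "T1 = \<bar>T\<bar> + real CARD('n) + 2"
  have T1: "T1 \<ge> 2" "T1 \<ge> real CARD('n) + 1" unfolding T1_def by auto
  obtain K where K: "0 < K"
    "\<And>p y. y \<in> cube p \<Longrightarrow> C (ball y (T1 * side (fst p))) \<le> ennreal K * C (cube p)"
    using cube_scale by blast
  show thesis
  proof (rule that[of "3 * K"])
    fix F :: "(int \<times> (int ^ 'n)) set" and R :: real and A :: ennreal
    assume R: "0 < R" and A: "1 \<le> A"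
      and F: "\<And>p. p \<in> F \<Longrightarrow> fst p \<le> 0 \<and> cube p \<subseteq> ball xQ R"
    define J where "J = tops F"
    define w where "w p = C (cube p)" for p
    have J: "fst p \<le> 0" "cube p \<subseteq> ball xQ R" if "p \<in> J" for p
      using F that unfolding J_def tops_def by auto
    obtain S where S: "S \<subseteq> J"
      "\<And>q. q \<in> dyadic_cubes xQ l \<Longrightarrow> (\<Sum>\<^sub>\<infinity>i\<in>{i\<in>S. cube i \<subseteq> q}. w i) \<le> A * C q"
      "\<And>j. j \<in> J - S \<Longrightarrow> \<exists>q\<in>dyadic_cubes xQ l. cube j \<subseteq> q \<and>
        C q \<le> 3 * (\<Sum>\<^sub>\<infinity>i\<in>{i\<in>S. cube i \<subseteq> q}. w i)"
    proof (rule packed_subfamily[of J w "C (ball xQ R)" "dyadic_cubes xQ l" "\<lambda>p q. cube p \<subseteq> q" C A])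
      show "w j \<le> C (ball xQ R)" if "j \<in> J" for j
        unfolding w_def by (intro cap_mono J that)
      show "w j \<le> C q" if "cube j \<subseteq> q" for j q
        unfolding w_def by (intro cap_mono that)
    qed (use A in \<open>auto simp: w_def cube_pos ball_fin[simplified]\<close>)
    define \<Sigma> where "\<Sigma> = (\<Sum>\<^sub>\<infinity>i\<in>S. w i)"
    have sub_le: "(\<Sum>\<^sub>\<infinity>i\<in>{i\<in>S. cube i \<subseteq> q}. w i) \<le> \<Sigma>" for q
      unfolding \<Sigma>_def by (intro infsum_mono_set_ennreal) auto
    have cover: "\<exists>q\<in>dyadic_cubes xQ l. cube j \<subseteq> q \<and>
        C q \<le> 3 * (\<Sum>\<^sub>\<infinity>i\<in>{i\<in>S. cube i \<subseteq> q}. w i)" if j: "j \<in> J" for j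
    proof (cases "j \<in> S")
      case True
      have "C (cube j) \<le> 1 * (\<Sum>\<^sub>\<infinity>i\<in>{i\<in>S. cube i \<subseteq> cube j}. w i)"
        using sum_le_infsum_ennreal[of "{j}" "{i\<in>S. cube i \<subseteq> cube j}" w] True
        by (simp flip: w_def)
      also have "\<dots> \<le> 3 * (\<Sum>\<^sub>\<infinity>i\<in>{i\<in>S. cube i \<subseteq> cube j}. w i)"
        by (intro mult_right_mono) auto
      finally show ?thesis using cube_in_dyadic_cubes by blast
    qed (use S(3) j in blast)
    define E where "E = ball xQ R \<inter> (\<Union>p\<in>J. \<Union>y\<in>cube p. ball y (T * side (fst p)))"
    have "C E \<le> ennreal K * (3 * \<Sigma>)"
    proof (cases "\<exists>q\<in>dyadic_cubes xQ l. C (ball xQ R) \<le> ennreal K * C q \<and>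
        C q \<le> 3 * (\<Sum>\<^sub>\<infinity>i\<in>{i\<in>S. cube i \<subseteq> q}. w i)")
      case True
      then obtain q where q: "C (ball xQ R) \<le> ennreal K * C q"
        "C q \<le> 3 * (\<Sum>\<^sub>\<infinity>i\<in>{i\<in>S. cube i \<subseteq> q}. w i)" by blast
      have "C E \<le> C (ball xQ R)" unfolding E_def by (intro cap_mono) auto
      also note q(1)
      also have "C q \<le> 3 * \<Sigma>"
        using q(2) mult_left_mono[OF sub_le[of q], of 3] by auto
      then have "ennreal K * C q \<le> ennreal K * (3 * \<Sigma>)" by (intro mult_left_mono) auto
      finally show ?thesis .
    next
      case False
      \<comment> \<open>\<open>R \<le> side N\<close> puts quadrants and cubes above level
        \<open>N\<close> under the case just excluded; \<open>0 \<le> N\<close> admits the cubes of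
        \<open>J\<close> themselves.\<close>
      obtain N where N: "0 \<le> N" "R \<le> side N" using ex_large_side by blast
      define G where
        "G = {p. fst p \<le> N \<and> C (cube p) \<le> 3 * (\<Sum>\<^sub>\<infinity>i\<in>{i\<in>S. cube i \<subseteq> cube p}. w i)}"
      have G_level: "fst p \<le> N" if "p \<in> G" for p using that unfolding G_def by simp
      have small: "\<exists>p\<in>G. cube j \<subseteq> cube p \<and> fst j \<le> fst p" if j: "j \<in> J" for j
      proof -
        obtain q where q: "q \<in> dyadic_cubes xQ l" "cube j \<subseteq> q"
          "C q \<le> 3 * (\<Sum>\<^sub>\<infinity>i\<in>{i\<in>S. cube i \<subseteq> q}. w i)" using cover[OF j] by blast
        have notbig: "\<not> C (ball xQ R) \<le> ennreal K * C q" using False q by blast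
        \<comment> \<open>A grid cube inside \<open>q\<close> whose dilate swallows the ball around
          \<open>xQ\<close> would put \<open>q\<close> in the excluded case.\<close>
        have contains: False
          if "y \<in> cube p" "cube p \<subseteq> q" "ball xQ R \<subseteq> ball y (T1 * side (fst p))" for y p
        proof -
          have "C (ball xQ R) \<le> C (ball y (T1 * side (fst p)))" by (rule cap_mono[OF that(3)])
          also have "\<dots> \<le> ennreal K * C (cube p)" by (rule K(2)[OF that(1)])
          also have "\<dots> \<le> ennreal K * C q" by (intro mult_left_mono cap_mono that) auto
          finally show False using notbig by blast
        qed
        have "q \<notin> dyadic_quadrants xQ"
        proof
          assume "q \<in> dyadic_quadrants xQ"
          then obtain m where m: "cube (N, m) \<subseteq> q"
            "\<And>y. y \<in> cube (N, m) \<Longrightarrow> dist y xQ \<le> real CARD('n) * side N"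
            using quadrant_contains_cube by blast
          have "ball xQ R \<subseteq> ball (centre (N, m)) (T1 * side (fst (N, m)))"
          proof (rule ball_subset_ball_iff[THEN iffD2], rule disjI1)
            have "dist xQ (centre (N, m)) + R \<le> real CARD('n) * side N + side N"
              using m(2)[OF centre_in_cube] N by (simp add: dist_commute)
            also have "\<dots> \<le> T1 * side N"
              using mult_right_mono[OF T1(2), of "side N"] side_pos[of N] by (simp add: algebra_simps)
            finally show "dist xQ (centre (N, m)) + R \<le> T1 * side (fst (N, m))" by simp
          qed
          then show False using contains[OF centre_in_cube m(1)] by blast
        qed
        then obtain p where p: "q = cube p"
          using q(1) unfolding dyadic_cubes_def dyadic_cubes0_eq by auto
        have le_N: "fst p \<le> N"
        proof (rule ccontr)
          assume "\<not> fst p \<le> N"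
          then have s: "R \<le> side (fst p)" using N side_mono[of N "fst p"] by auto
          define y where "y = centre j"
          have yj: "y \<in> cube j" unfolding y_def using centre_in_cube[of "fst j" "snd j"] by simp
          then have "dist xQ y + R \<le> 2 * R" using J(2)[OF j] by auto
          also have "2 * R \<le> T1 * side (fst p)" using T1(1) s R by (intro mult_mono) auto
          finally have "ball xQ R \<subseteq> ball y (T1 * side (fst p))"
            by (intro ball_subset_ball_iff[THEN iffD2] disjI1)
          then show False using contains[of y p] yj q(2) p by auto
        qed
        show ?thesis
        proof (cases "fst j \<le> fst p")
          case True
          then show ?thesis using le_N p q unfolding G_def by (intro bexI[of _ p]) auto
        next
          case False
          \<comment> \<open>Here \<open>p\<close> and \<open>j\<close> index the same set, so
            \<open>j\<close> takes the place of \<open>p\<close>. This secures the order of levels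
            needed to compare the dilates.\<close>
          then have "cube j = cube p"
            using cube_subset_level[of "fst j" "snd j" "fst p" "snd p"] q(2) p by simp
          then show ?thesis using q(3) p J(1)[OF j] N(1) unfolding G_def by (intro bexI[of _ j]) auto
        qed
      qed
      have "E \<subseteq> (\<Union>p\<in>tops G. ball (centre p) (T1 * side (fst p)))"
      proof
        fix x assume "x \<in> E"
        then obtain j y where j: "j \<in> J" "y \<in> cube j" "dist y x < T * side (fst j)"
          unfolding E_def by auto
        obtain p0 where p0: "p0 \<in> G" "cube j \<subseteq> cube p0" "fst j \<le> fst p0" using small[OF j(1)] by blast
        obtain p where p: "p \<in> tops G" "fst p0 \<le> fst p" "cube p0 \<subseteq> cube p"
          using ex_tops[OF p0(1), of N] G_level by blast
        have "T * side (fst j) \<le> \<bar>T\<bar> * side (fst p)"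
          using side_mono[of "fst j" "fst p"] side_pos[of "fst j"] p0(3) p(2) by (intro mult_mono) auto
        moreover have "dist (centre p) y \<le> real CARD('n) * side (fst p)"
          using dist_cube[of "centre p" "fst p" "snd p" y] centre_in_cube[of "fst p" "snd p"]
            j(2) p0(2) p(3) by auto
        ultimately have "dist (centre p) x < \<bar>T\<bar> * side (fst p) + real CARD('n) * side (fst p)"
          using j(3) dist_triangle[of "centre p" x y] by linarith
        also have "\<dots> \<le> T1 * side (fst p)"
          unfolding T1_def using side_pos[of "fst p"] by (simp add: algebra_simps)
        finally show "x \<in> (\<Union>p\<in>tops G. ball (centre p) (T1 * side (fst p)))"
          using p(1) by auto
      qed
      then have "C E \<le> (\<Sum>\<^sub>\<infinity>p\<in>tops G. C (ball (centre p) (T1 * side (fst p))))"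
        by (rule cap_UN)
      also have "\<dots> \<le> (\<Sum>\<^sub>\<infinity>p\<in>tops G. ennreal K * (3 * (\<Sum>\<^sub>\<infinity>i\<in>{i\<in>S. cube i \<subseteq> cube p}. w i)))"
      proof (rule infsum_mono_ennreal)
        fix p assume "p \<in> tops G"
        then have "C (cube p) \<le> 3 * (\<Sum>\<^sub>\<infinity>i\<in>{i\<in>S. cube i \<subseteq> cube p}. w i)"
          unfolding tops_def G_def by auto
        then have "ennreal K * C (cube p) \<le> ennreal K * (3 * (\<Sum>\<^sub>\<infinity>i\<in>{i\<in>S. cube i \<subseteq> cube p}. w i))"
          by (intro mult_left_mono) auto
        moreover have "C (ball (centre p) (T1 * side (fst p))) \<le> ennreal K * C (cube p)"
          using K(2)[of "centre p" p] centre_in_cube[of "fst p" "snd p"] by simp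
        ultimately show "C (ball (centre p) (T1 * side (fst p)))
            \<le> ennreal K * (3 * (\<Sum>\<^sub>\<infinity>i\<in>{i\<in>S. cube i \<subseteq> cube p}. w i))"
          by (rule order_trans[rotated])
      qed
      also have "\<dots> = ennreal K * (3 * (\<Sum>\<^sub>\<infinity>p\<in>tops G. \<Sum>\<^sub>\<infinity>i\<in>{i\<in>S. cube i \<subseteq> cube p}. w i))"
        by (simp add: infsum_cmult_ennreal)
      \<comment> \<open>A selected cube is nonempty, so it cannot lie in two disjoint tops, and the
        inner sums add up to at most \<open>\<Sigma>\<close>.\<close>
      also have "\<dots> \<le> ennreal K * (3 * \<Sigma>)"
        unfolding \<Sigma>_def
      proof (intro mult_left_mono infsum_disjoint_UN_le_ennreal)
        fix p q assume "p \<in> tops G" "q \<in> tops G" "p \<noteq> q"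
        then have "cube p \<inter> cube q = {}" by (rule tops_disjoint)
        then show "{i\<in>S. cube i \<subseteq> cube p} \<inter> {i\<in>S. cube i \<subseteq> cube q} = {}"
          using centre_in_cube by fastforce
      qed auto
      finally show ?thesis .
    qed
    also have "\<dots> = ennreal (3 * K) * \<Sigma>"
      using K(1) by (simp add: ennreal_mult mult_ac)
    finally have "C E \<le> ennreal (3 * K) * \<Sigma>" .
    then show "\<exists>S\<subseteq>tops F.
        (\<forall>q\<in>dyadic_cubes xQ l. (\<Sum>\<^sub>\<infinity>i\<in>{i\<in>S. cube i \<subseteq> q}. C (cube i)) \<le> A * C q) \<and>
        C (ball xQ R \<inter> (\<Union>p\<in>tops F. \<Union>y\<in>cube p. ball y (T * side (fst p))))
          \<le> ennreal (3 * K) * (\<Sum>\<^sub>\<infinity>i\<in>S. C (cube i))"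
      using S(1,2) unfolding J_def E_def w_def \<Sigma>_def by blast
  qed (use K(1) in simp)
qed

text \<open>If every neighbouring cube of the right scale had a small average, then summing over
  this cover of the ball and bounding the capacity of each cube by doubling would contradict the
  hypothesis. Hence \<open>K\<close> is the number of neighbours times a doubling constant.\<close>

lemma ball_average_le_cube_average:
  obtains K where "0 < K"
    "\<And>x r h c. 0 < r \<Longrightarrow> r \<le> l \<Longrightarrow> ennreal (K * c) * C (ball x r) < ch (ball x r) h \<Longrightarrow> 0 < c \<Longrightarrow>
      \<exists>p. fst p \<le> 0 \<and> ennreal c * C (cube p) < ch (cube p) h \<and>
        (\<forall>y\<in>cube p. dist y x \<le> real CARD('n) * (2 * side (fst p)))"
proof -
  \<comment> \<open>As \<open>side k < 2 * r\<close>, the neighbouring cubes stay within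
    \<open>4 * real CARD('n) * r\<close> of \<open>x\<close>; the extra 2 makes the bound
    strict.\<close>
  obtain K where K: "0 < K"
    "\<And>x r. 0 < r \<Longrightarrow> C (ball x ((4 * real CARD('n) + 2) * r)) \<le> ennreal K * C (ball x r)"
    using ball_scale by blast
  define M where "M = real (card neighbours)"
  have "0 \<in> neighbours" unfolding neighbours_def by simp
  then have M: "0 < M" unfolding M_def using finite_neighbours by (auto simp: card_gt_0_iff)
  show thesis
  proof (rule that)
    show "0 < M * K" using M K by simp
    fix x r h and c :: real
    assume r: "0 < r" "r \<le> l" and less: "ennreal (M * K * c) * C (ball x r) < ch (ball x r) h"
      and c: "0 < c"
    obtain k where k: "k \<le> 0" "r \<le> side k" "side k < 2 * r" using ex_level[OF r] by blast
    obtain m where m: "x \<in> cube (k, m)" using ex_cube by blast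
    have "\<exists>v\<in>neighbours. ennreal c * C (cube (k, m + v)) < ch (cube (k, m + v)) h"
    proof (rule ccontr)
      assume "\<not> ?thesis"
      then have le: "ch (cube (k, m + v)) h \<le> ennreal c * C (cube (k, m + v))"
        if "v \<in> neighbours" for v using that by (auto simp: not_less)
      have "ch (ball x r) h \<le> (\<Sum>v\<in>neighbours. ch (cube (k, m + v)) h)"
        by (rule choquet_UN[OF finite_neighbours ball_subset_neighbours[OF m k(2)]])
      also have "\<dots> \<le> (\<Sum>v\<in>neighbours. ennreal c * (ennreal K * C (ball x r)))"
      proof (rule sum_mono)
        fix v assume v: "v \<in> neighbours"
        have "cube (k, m + v) \<subseteq> ball x ((4 * real CARD('n) + 2) * r)"
        proof
          fix y assume "y \<in> cube (k, m + v)"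
          then have "dist y x \<le> real CARD('n) * (2 * side k)" by (rule dist_neighbour[OF m v])
          also have "\<dots> \<le> real CARD('n) * (2 * (2 * r))"
            using k(3) by (intro mult_left_mono) auto
          also have "\<dots> < (4 * real CARD('n) + 2) * r" using r by (simp add: algebra_simps)
          finally show "y \<in> ball x ((4 * real CARD('n) + 2) * r)" by (simp add: dist_commute)
        qed
        then have "C (cube (k, m + v)) \<le> ennreal K * C (ball x r)"
          using K(2)[OF r(1), of x] cap_mono order_trans by blast
        then show "ch (cube (k, m + v)) h \<le> ennreal c * (ennreal K * C (ball x r))"
          using le[OF v] mult_left_mono[of _ _ "ennreal c"] by (auto intro: order_trans)
      qed
      also have "\<dots> = ennreal (M * K * c) * C (ball x r)"
        using K(1) c by (simp add: M_def ennreal_mult ennreal_of_nat_eq_real_of_nat mult_ac)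
      finally show False using less by simp
    qed
    then obtain v where v: "v \<in> neighbours"
      "ennreal c * C (cube (k, m + v)) < ch (cube (k, m + v)) h" by blast
    then show "\<exists>p. fst p \<le> 0 \<and> ennreal c * C (cube p) < ch (cube p) h \<and>
        (\<forall>y\<in>cube p. dist y x \<le> real CARD('n) * (2 * side (fst p)))"
      using k(1) dist_neighbour[OF m v(1)] by (intro exI[of _ "(k, m + v)"]) auto
  qed
qed

text \<open>The constant is fixed before \<open>h\<close>, so the right side can later be made small
  by the choice of \<open>h\<close> while \<open>c\<close> and \<open>R\<close> stay put.\<close>

lemma weak_type:
  assumes "packing_assumption xQ l C"
  obtains A where "0 < A"
    "\<And>h c R. 0 < c \<Longrightarrow>
      ennreal c * C {x \<in> ball xQ R. \<exists>r. 0 < r \<and> r \<le> l \<and> ennreal c * C (ball x r) < ch (ball x r) h}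
        \<le> ennreal A * ch UNIV h"
proof -
  let ?n = "real CARD('n)"
  obtain A0 :: real where A0: "1 \<le> A0" and pack: "\<And>S h. S \<subseteq> dyadic_cubes xQ l \<Longrightarrow> non_overlapping S \<Longrightarrow>
      (\<forall>Q'\<in>dyadic_cubes xQ l. (\<Sum>\<^sub>\<infinity>P\<in>{P \<in> S. P \<subseteq> Q'}. C P) \<le> ennreal A0 * C Q') \<Longrightarrow>
      (\<Sum>\<^sub>\<infinity>P\<in>S. ch P h) \<le> ennreal A0 * ch (\<Union>S) h"
    using assms unfolding packing_assumption_def by blast
  obtain K1 where K1: "0 < K1"
    "\<And>x r h c. 0 < r \<Longrightarrow> r \<le> l \<Longrightarrow> ennreal (K1 * c) * C (ball x r) < ch (ball x r) h \<Longrightarrow> 0 < c \<Longrightarrow>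
      \<exists>p. fst p \<le> 0 \<and> ennreal c * C (cube p) < ch (cube p) h \<and>
        (\<forall>y\<in>cube p. dist y x \<le> ?n * (2 * side (fst p)))"
    using ball_average_le_cube_average by blast
  obtain K2 where K2: "0 < K2"
    "\<And>F R A. 0 < R \<Longrightarrow> 1 \<le> A \<Longrightarrow> (\<And>p. p \<in> F \<Longrightarrow> fst p \<le> 0 \<and> cube p \<subseteq> ball xQ R) \<Longrightarrow>
      \<exists>S\<subseteq>tops F.
        (\<forall>q\<in>dyadic_cubes xQ l. (\<Sum>\<^sub>\<infinity>i\<in>{i\<in>S. cube i \<subseteq> q}. C (cube i)) \<le> A * C q) \<and>
        C (ball xQ R \<inter> (\<Union>p\<in>tops F. \<Union>y\<in>cube p. ball y ((2 * ?n + 1) * side (fst p))))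
          \<le> ennreal K2 * (\<Sum>\<^sub>\<infinity>i\<in>S. C (cube i))"
    using packed_covering[of "2 * ?n + 1"] by blast
  show thesis
  proof (rule that)
    show "0 < K1 * K2 * A0" using K1 K2 A0 by simp
    fix h :: "real ^ 'n \<Rightarrow> ennreal" and c R :: real
    assume c: "0 < c"
    define E where
      "E = {x \<in> ball xQ R. \<exists>r. 0 < r \<and> r \<le> l \<and> ennreal c * C (ball x r) < ch (ball x r) h}"
    \<comment> \<open>A cube found from a point of the ball has level at most 0, so it stays within
      \<open>2 * ?n * l\<close> of that point; \<open>\<bar>R\<bar>\<close> keeps \<open>R'\<close>
      positive for every \<open>R\<close>.\<close>
    define R' where "R' = \<bar>R\<bar> + (2 * ?n + 1) * l"
    have R': "0 < R'" unfolding R'_def using l_pos by (intro add_nonneg_pos) auto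
    \<comment> \<open>Dividing \<open>c\<close> by \<open>K1\<close> pays for passing from balls to
      cubes.\<close>
    define F where
      "F = {p. fst p \<le> 0 \<and> ennreal (c / K1) * C (cube p) < ch (cube p) h \<and> cube p \<subseteq> ball xQ R'}"
    have "1 \<le> ennreal A0" using A0 by simp
    then obtain S where S: "S \<subseteq> tops F"
      "\<forall>q\<in>dyadic_cubes xQ l. (\<Sum>\<^sub>\<infinity>i\<in>{i\<in>S. cube i \<subseteq> q}. C (cube i)) \<le> ennreal A0 * C q"
      "C (ball xQ R' \<inter> (\<Union>p\<in>tops F. \<Union>y\<in>cube p. ball y ((2 * ?n + 1) * side (fst p))))
          \<le> ennreal K2 * (\<Sum>\<^sub>\<infinity>i\<in>S. C (cube i))"
      using K2(2)[of R' "ennreal A0" F] R' unfolding F_def by auto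
    have inj: "inj_on cube S" using inj_on_cube_tops S(1) inj_on_subset by blast
    have "(\<Sum>\<^sub>\<infinity>P\<in>cube ` S. ch P h) \<le> ennreal A0 * ch (\<Union>(cube ` S)) h"
    proof (rule pack)
      show "cube ` S \<subseteq> dyadic_cubes xQ l" using cube_in_dyadic_cubes by auto
      show "non_overlapping (cube ` S)"
        using non_overlapping_tops S(1) unfolding non_overlapping_def
        by (meson image_mono pairwise_subset)
      show "\<forall>Q'\<in>dyadic_cubes xQ l. (\<Sum>\<^sub>\<infinity>P\<in>{P \<in> cube ` S. P \<subseteq> Q'}. C P) \<le> ennreal A0 * C Q'"
      proof
        fix q assume q: "q \<in> dyadic_cubes xQ l"
        have "{P \<in> cube ` S. P \<subseteq> q} = cube ` {i\<in>S. cube i \<subseteq> q}" by auto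
        moreover have "inj_on cube {i\<in>S. cube i \<subseteq> q}" using inj by (rule inj_on_subset) auto
        ultimately show "(\<Sum>\<^sub>\<infinity>P\<in>{P \<in> cube ` S. P \<subseteq> q}. C P) \<le> ennreal A0 * C q"
          using S(2) q by (simp add: infsum_reindex comp_def)
      qed
    qed
    also have "\<dots> \<le> ennreal A0 * ch UNIV h"
      by (intro mult_left_mono choquet_mono) auto
    finally have sum_ch: "(\<Sum>\<^sub>\<infinity>p\<in>S. ch (cube p) h) \<le> ennreal A0 * ch UNIV h"
      using inj by (simp add: infsum_reindex comp_def)
    have "ennreal (c / K1) * (\<Sum>\<^sub>\<infinity>i\<in>S. C (cube i)) = (\<Sum>\<^sub>\<infinity>i\<in>S. ennreal (c / K1) * C (cube i))"
      by (simp add: infsum_cmult_ennreal)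
    also have "\<dots> \<le> (\<Sum>\<^sub>\<infinity>i\<in>S. ch (cube i) h)"
      by (rule infsum_mono_ennreal) (use S(1) in \<open>auto simp: tops_def F_def intro: less_imp_le\<close>)
    also note sum_ch
    finally have sum_w: "ennreal (c / K1) * (\<Sum>\<^sub>\<infinity>i\<in>S. C (cube i)) \<le> ennreal A0 * ch UNIV h" .
    have "E \<subseteq> ball xQ R' \<inter> (\<Union>p\<in>tops F. \<Union>y\<in>cube p. ball y ((2 * ?n + 1) * side (fst p)))"
    proof
      fix x assume x: "x \<in> E"
      then obtain r where r: "0 < r" "r \<le> l" "ennreal c * C (ball x r) < ch (ball x r) h"
        unfolding E_def by blast
      then obtain p where p: "fst p \<le> 0" "ennreal (c / K1) * C (cube p) < ch (cube p) h"
        "\<And>y. y \<in> cube p \<Longrightarrow> dist y x \<le> ?n * (2 * side (fst p))"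
        using K1(2)[of r "c / K1" x h] K1(1) c by auto
      have xR: "dist xQ x < \<bar>R\<bar>" using x unfolding E_def by auto
      have sl: "side (fst p) \<le> l" using side_mono[OF p(1)] side_0 by simp
      have "cube p \<subseteq> ball xQ R'"
      proof
        fix y assume "y \<in> cube p"
        then have "dist y x \<le> ?n * (2 * side (fst p))" by (rule p(3))
        also have "\<dots> \<le> ?n * (2 * l)" using sl by (intro mult_left_mono) auto
        also have "\<dots> \<le> (2 * ?n + 1) * l" using l_pos by (simp add: algebra_simps)
        finally show "y \<in> ball xQ R'"
          using xR dist_triangle[of xQ y x] unfolding R'_def by (simp add: dist_commute)
      qed
      then have "p \<in> F" unfolding F_def using p by auto
      moreover have "fst q \<le> 0" if "q \<in> F" for q using that unfolding F_def by simp
      ultimately obtain q where q: "q \<in> tops F" "fst p \<le> fst q" "cube p \<subseteq> cube q"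
        using ex_tops[of p F 0] by blast
      \<comment> \<open>The distance bound belongs to \<open>p\<close>, while only the top
        \<open>q\<close> is available. A ball about a point of \<open>p\<close> with radius
        proportional to \<open>side (fst q)\<close> still reaches \<open>x\<close>; this is why the
        covering uses balls about all points of a top.\<close>
      define y where "y = centre p"
      have y: "y \<in> cube p" unfolding y_def using centre_in_cube[of "fst p" "snd p"] by simp
      have "dist y x \<le> ?n * (2 * side (fst p))" by (rule p(3)[OF y])
      also have "\<dots> \<le> ?n * (2 * side (fst q))" by (intro mult_left_mono side_mono q(2)) auto
      also have "\<dots> < (2 * ?n + 1) * side (fst q)"
        using side_pos[of "fst q"] by (simp add: algebra_simps)
      finally have "x \<in> ball y ((2 * ?n + 1) * side (fst q))" by simp
      moreover have "x \<in> ball xQ R'"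
        using xR l_pos unfolding R'_def by (simp add: add_strict_increasing2 less_le_trans)
      ultimately show
        "x \<in> ball xQ R' \<inter> (\<Union>p\<in>tops F. \<Union>y\<in>cube p. ball y ((2 * ?n + 1) * side (fst p)))"
        using q(1,3) y by blast
    qed
    then have "C E \<le> ennreal K2 * (\<Sum>\<^sub>\<infinity>i\<in>S. C (cube i))"
      using S(3) cap_mono order_trans by blast
    then have "ennreal c * C E \<le> ennreal c * (ennreal K2 * (\<Sum>\<^sub>\<infinity>i\<in>S. C (cube i)))"
      by (intro mult_left_mono) auto
    also have "\<dots> = ennreal (K1 * K2) * (ennreal (c / K1) * (\<Sum>\<^sub>\<infinity>i\<in>S. C (cube i)))"
    proof -
      have "ennreal c * ennreal K2 = ennreal (K1 * K2) * ennreal (c / K1)"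
        using K1(1) K2(1) c by (simp flip: ennreal_mult)
      then show ?thesis by (metis mult.assoc)
    qed
    also have "\<dots> \<le> ennreal (K1 * K2) * (ennreal A0 * ch UNIV h)"
      by (intro mult_left_mono sum_w) auto
    also have "\<dots> = ennreal (K1 * K2 * A0) * ch UNIV h"
      using K1(1) K2(1) A0 by (simp add: ennreal_mult mult.assoc)
    finally show "ennreal c * C {x \<in> ball xQ R. \<exists>r. 0 < r \<and> r \<le> l \<and>
        ennreal c * C (ball x r) < ch (ball x r) h} \<le> ennreal (K1 * K2 * A0) * ch UNIV h"
      unfolding E_def .
  qed
qed

end

section \<open>Lebesgue points\<close>

context doubling_cap
begin

text \<open>\<open>choquet_add_le\<close> doubles both terms, so each is allowed c / 4. The final
  cancellation rests on the ball having positive finite capacity.\<close>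

lemma average_le:
  assumes r: "0 < r" and c: "0 < c"
    and h: "ch (ball x r) h \<le> ennreal (c / 4) * C (ball x r)"
    and le: "\<And>y. y \<in> ball x r \<Longrightarrow> u y \<le> h y + ennreal (c / 4)"
  shows "choquet_average C (ball x r) u \<le> ennreal c"
proof -
  let ?c = "C (ball x r)"
  have "ch (ball x r) u \<le> 2 * ch (ball x r) h + 2 * ch (ball x r) (\<lambda>_. ennreal (c / 4))"
    by (rule choquet_add_le[OF le])
  also have "\<dots> \<le> 2 * (ennreal (c / 4) * ?c) + 2 * (ennreal (c / 4) * ?c)"
    by (intro add_mono mult_left_mono h choquet_le_const) (use c in auto)
  also have "\<dots> = (2 * ennreal (c / 4) + 2 * ennreal (c / 4)) * ?c"
    by (simp add: distrib_right mult.assoc)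
  also have "2 * ennreal (c / 4) + 2 * ennreal (c / 4) = ennreal c"
  proof -
    have "2 * ennreal (c / 4) = ennreal (c / 2)" using c ennreal_mult[of 2 "c / 4"] by simp
    then show ?thesis using c ennreal_plus[of "c / 2" "c / 2"] by simp
  qed
  finally have "1 / ?c * ch (ball x r) u \<le> 1 / ?c * (ennreal c * ?c)" by (rule mult_left_mono) simp
  also have "\<dots> = ennreal c * (?c / ?c)"
    by (simp add: ennreal_times_divide mult.commute ennreal_divide_times)
  also have "\<dots> = ennreal c" using ball_pos[OF r, of x] ball_fin[of x r] by simp
  finally show ?thesis unfolding choquet_average_def by simp
qed

text \<open>At small radii a continuous \<open>g\<close> hardly oscillates, so at a bad point either
  \<open>f - g\<close> or its local maximal function is large. Both sets have capacity at most a
  multiple of the integral of \<open>\<bar>f - g\<bar>\<close>, which is arbitrarily small.\<close>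

lemma exceptional_null:
  assumes pack: "packing_assumption xQ l C" and f: "f \<in> L1_capacity C" and c: "0 < c"
  shows "C {x \<in> ball xQ R. \<not> (\<exists>d>0. \<forall>r. 0 < r \<longrightarrow> r < d \<longrightarrow>
    choquet_average C (ball x r) (\<lambda>y. ennreal \<bar>f y - f x\<bar>) \<le> ennreal c)} = 0" (is "C ?B = 0")
proof -
  obtain A where A: "0 < A"
    "\<And>h c R. 0 < c \<Longrightarrow>
      ennreal c * C {x \<in> ball xQ R. \<exists>r. 0 < r \<and> r \<le> l \<and> ennreal c * C (ball x r) < ch (ball x r) h}
        \<le> ennreal A * ch UNIV h"
    using weak_type[OF pack] by blast
  \<comment> \<open>8 comes from the Markov inequality at height c / 8, and 4 A from the weak-type
    estimate at height c / 4.\<close>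
  have small: "ennreal c * C ?B \<le> ennreal ((8 + 4 * A) * e)" if e: "0 < e" for e
  proof -
    obtain g where g: "continuous_on UNIV g" "ch UNIV (\<lambda>x. ennreal \<bar>f x - g x\<bar>) < ennreal e"
      using continuous_approximation[OF f e] by blast
    define h where "h x = ennreal \<bar>f x - g x\<bar>" for x
    \<comment> \<open>Off \<open>B1\<close> the value of \<open>\<bar>f - g\<bar>\<close> at the
      point takes c / 8, and the oscillation of \<open>g\<close> takes another c / 8: together the c
      / 4 that \<open>average_le\<close> allows.\<close>
    define B1 where "B1 = {x \<in> UNIV. ennreal (c / 8) < h x}"
    define B2 where
      "B2 = {x \<in> ball xQ R. \<exists>r. 0 < r \<and> r \<le> l \<and> ennreal (c / 4) * C (ball x r) < ch (ball x r) h}"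
    have "?B \<subseteq> B1 \<union> B2"
    proof (rule ccontr)
      assume "\<not> ?B \<subseteq> B1 \<union> B2"
      then obtain x where x: "x \<in> ?B" "x \<notin> B1" "x \<notin> B2" by blast
      have "\<bar>f x - g x\<bar> \<le> c / 8"
        using x(2) c unfolding B1_def h_def by (simp add: not_less)
      have "continuous (at x) g" using g(1) by (simp add: continuous_on_eq_continuous_at)
      then obtain d where d: "0 < d" "\<And>y. dist y x < d \<Longrightarrow> dist (g y) (g x) < c / 8"
        using c unfolding continuous_at_eps_delta by (meson divide_pos_pos zero_less_numeral)
      have "choquet_average C (ball x r) (\<lambda>y. ennreal \<bar>f y - f x\<bar>) \<le> ennreal c"
        if r: "0 < r" "r < min d l" for r
      proof (rule average_le[OF r(1) c])
        show "ch (ball x r) h \<le> ennreal (c / 4) * C (ball x r)"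
        proof (rule ccontr)
          assume "\<not> ch (ball x r) h \<le> ennreal (c / 4) * C (ball x r)"
          then have "x \<in> B2"
            using x(1) r unfolding B2_def by (auto simp: not_le intro!: exI[of _ r])
          then show False using x(3) by blast
        qed
        fix y assume "y \<in> ball x r"
        then have "dist y x < d" using r by (simp add: dist_commute)
        then have "\<bar>g y - g x\<bar> < c / 8" using d(2) by (simp add: dist_real_def)
        then have "\<bar>f y - f x\<bar> \<le> \<bar>f y - g y\<bar> + c / 4"
          using \<open>\<bar>f x - g x\<bar> \<le> c / 8\<close> by linarith
        then show "ennreal \<bar>f y - f x\<bar> \<le> h y + ennreal (c / 4)"
          using c unfolding h_def by (simp flip: ennreal_plus)
      qed
      then have "\<exists>d>0. \<forall>r. 0 < r \<longrightarrow> r < d \<longrightarrow>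
          choquet_average C (ball x r) (\<lambda>y. ennreal \<bar>f y - f x\<bar>) \<le> ennreal c"
        using d(1) l_pos by (intro exI[of _ "min d l"]) auto
      then show False using x(1) by blast
    qed
    then have "C ?B \<le> C B1 + C B2" using cap_mono cap_Un order_trans by meson
    then have "ennreal c * C ?B \<le> ennreal c * (C B1 + C B2)" by (rule mult_left_mono) simp
    also have "\<dots> = 8 * (ennreal (c / 8) * C B1) + 4 * (ennreal (c / 4) * C B2)"
    proof -
      have "8 * ennreal (c / 8) = ennreal c" "4 * ennreal (c / 4) = ennreal c"
        using c ennreal_mult[of 8 "c / 8"] ennreal_mult[of 4 "c / 4"] by simp_all
      then show ?thesis by (metis distrib_left mult.assoc)
    qed
    also have "\<dots> \<le> 8 * ch UNIV h + 4 * (ennreal A * ch UNIV h)"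
      unfolding B1_def B2_def
      by (intro add_mono mult_left_mono choquet_Markov A(2)) (use c in auto)
    also have "\<dots> = ennreal (8 + 4 * A) * ch UNIV h"
      using A(1) by (simp add: ennreal_mult distrib_right mult.assoc)
    also have "\<dots> \<le> ennreal (8 + 4 * A) * ennreal e"
      using g(2) unfolding h_def by (intro mult_left_mono) (auto intro: less_imp_le)
    also have "\<dots> = ennreal ((8 + 4 * A) * e)" using A(1) e by (intro ennreal_mult[symmetric]) auto
    finally show ?thesis .
  qed
  have "ennreal c * C ?B = 0"
  proof (rule ccontr)
    assume ne: "ennreal c * C ?B \<noteq> 0"
    have "ennreal c * C ?B < \<infinity>" using small[of 1] by (rule order.strict_trans1) auto
    then obtain u where u: "ennreal c * C ?B = ennreal u" "0 \<le> u"
      by (cases "ennreal c * C ?B") auto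
    with ne have "0 < u" by (auto simp: order_less_le)
    define e where "e = u / (2 * (8 + 4 * A))"
    have "8 + 4 * A \<noteq> 0" using A(1) by simp
    then have half: "(8 + 4 * A) * e = u / 2" by (simp add: e_def divide_simps)
    have "0 < e" unfolding e_def using \<open>0 < u\<close> A(1) by simp
    then have "ennreal u \<le> ennreal (u / 2)" using small[of e] unfolding u(1) half by blast
    then show False using \<open>0 < u\<close> by simp
  qed
  then show ?thesis using c by (simp add: ennreal_eq_0_iff)
qed

lemma quasi_every_Lebesgue_point:
  assumes pack: "packing_assumption xQ l C" and f: "f \<in> L1_capacity C"
  shows "quasi_every C (\<lambda>x.
    ((\<lambda>r. choquet_average C (ball x r) (\<lambda>y. ennreal \<bar>f y - f x\<bar>)) \<longlongrightarrow> 0) (at_right 0))"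
proof -
  define B where "B c R = {x \<in> ball xQ R. \<not> (\<exists>d>0. \<forall>r. 0 < r \<longrightarrow> r < d \<longrightarrow>
    choquet_average C (ball x r) (\<lambda>y. ennreal \<bar>f y - f x\<bar>) \<le> ennreal c)}" for c R
  \<comment> \<open>Thresholds 1 / (i + 1) and balls of radius j suffice, so the exceptional set is
    a countable union of null sets.\<close>
  define E where "E = (\<Union>i. \<Union>j. B (1 / real (Suc i)) (real j))"
  have null: "C E = 0"
    unfolding E_def B_def by (intro cap_null_UN exceptional_null[OF pack f]) simp
  have "((\<lambda>r. choquet_average C (ball x r) (\<lambda>y. ennreal \<bar>f y - f x\<bar>)) \<longlongrightarrow> 0) (at_right 0)"
    if "x \<notin> E" for x
  proof (rule order_tendstoI)
    fix a :: ennreal assume "0 < a"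
    then obtain z where z: "0 < z" "z < a" using dense by blast
    then obtain b where b: "0 < b" "ennreal b < a" by (cases z) auto
    obtain i where i: "1 / real (Suc i) < b" using nat_approx_posE[OF b(1)] by blast
    obtain j :: nat where "dist xQ x < j" using reals_Archimedean2 by blast
    then have "x \<in> ball xQ (real j)" by simp
    moreover have "x \<notin> B (1 / real (Suc i)) (real j)" using that unfolding E_def by blast
    ultimately obtain d where d: "d > 0" "\<And>r. 0 < r \<Longrightarrow> r < d \<Longrightarrow>
        choquet_average C (ball x r) (\<lambda>y. ennreal \<bar>f y - f x\<bar>) \<le> ennreal (1 / real (Suc i))"
      unfolding B_def by blast
    have "ennreal (1 / real (Suc i)) < a"
      using i b by (intro order.strict_trans1[OF _ b(2)] ennreal_leI) simp
    then show "eventually (\<lambda>r. choquet_average C (ball x r) (\<lambda>y. ennreal \<bar>f y - f x\<bar>) < a) (at_right 0)"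
      unfolding eventually_at_right_field using d order.strict_trans1 by blast
  qed simp
  then show ?thesis using null unfolding quasi_every_def by blast
qed

end

theorem theorem2:
  fixes C :: "(real ^ 'n) set \<Rightarrow> ennreal"
    and xQ :: "real ^ 'n"
    and l :: real
    and f :: "real ^ 'n \<Rightarrow> real"
  assumes "l > 0"
    and "outer_capacity C"
    and "packing_assumption xQ l C"
    and "doubling C"
    and "f \<in> L1_capacity C"
  shows "quasi_every C (\<lambda>x.
           ((\<lambda>r. choquet_average C (ball x r) (\<lambda>y. ennreal \<bar>f y - f x\<bar>)) \<longlongrightarrow> 0) (at_right 0))"
proof -
  interpret outer_cap C using assms(2) by unfold_locales
  obtain D where D: "0 < D" "\<And>x r. 0 < r \<Longrightarrow> C (ball x (2 * r)) \<le> ennreal D * C (ball x r)"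
    using assms(4) unfolding doubling_def by blast
  \<comment> \<open>A large enough multiple of one ball contains the other. The factor depends on
    the balls, but it is finite, which is enough to spread the values 0 and
    \<open>\<infinity>\<close>.\<close>
  have comparable: "\<exists>j. C (ball x r) \<le> ennreal (D ^ j) * C (ball y s)" if "0 < s" for x y r s
  proof -
    obtain j where j: "(dist x y + r) / s < 2 ^ j" using real_arch_pow[of 2 "(dist x y + r) / s"] by auto
    then have "ball x r \<subseteq> ball y (2 ^ j * s)"
      using that by (intro ball_subset_ball_iff[THEN iffD2]) (simp add: field_simps)
    then have "C (ball x r) \<le> C (ball y (2 ^ j * s))" by (rule cap_mono)
    also have "\<dots> \<le> ennreal (D ^ j) * C (ball y s)" by (rule double_power[OF D that])
    finally show ?thesis by blast
  qed
  show ?thesis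
  proof (cases "\<exists>x r. 0 < r \<and> (C (ball x r) = 0 \<or> C (ball x r) = \<infinity>)")
    case True
    then obtain y s where y: "0 < s" "C (ball y s) = 0 \<or> C (ball y s) = \<infinity>" by blast
    have "choquet_average C (ball x r) u = 0" if r: "0 < r" for x r u
    proof (cases "C (ball y s) = 0")
      case True
      then have "C (ball x r) = 0" using comparable[OF y(1), of x r y] by auto
      then show ?thesis by (simp add: choquet_average_def)
    next
      case False
      then have "C (ball x r) = \<infinity>"
        using y(2) comparable[OF r, of y s x] by (auto simp: top_unique ennreal_mult_eq_top_iff)
      then show ?thesis by (simp add: choquet_average_def)
    qed
    then have "((\<lambda>r. choquet_average C (ball x r) (\<lambda>y. ennreal \<bar>f y - f x\<bar>)) \<longlongrightarrow> 0) (at_right 0)" for x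
      by (intro tendsto_eventually) (auto simp: eventually_at_right_field intro!: exI[of _ 1])
    then show ?thesis unfolding quasi_every_def by (intro exI[of _ "{}"]) auto
  next
    case False
    then have pos: "0 < C (ball x r)" and fin: "C (ball x r) \<noteq> \<infinity>" if "0 < r" for x r
      using that by (auto simp: zero_less_iff_neq_zero)
    interpret doubling_cap C xQ l D
    proof unfold_locales
      \<comment> \<open>\<open>fin\<close> speaks of positive radii only; for the others the ball is
        empty.\<close>
      show "C (ball x r) < \<infinity>" for x r
        using fin[of r x] by (cases "0 < r") (auto simp: less_top ball_empty not_less)
    qed (use assms(1) D pos in auto)
    show ?thesis by (rule quasi_every_Lebesgue_point[OF assms(3,5)])
  qed
qed

end
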